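(* Let $q$ be a prime power not divisible by $2$ or $3$, let $n\ge1$, let $H=\mathrm{SL}_{2n}(\mathbb F_q)$ with Siegel parabolic subgroup $P$. Fix a nontrivial character $\psi\colon\mathbb F_q\to\mathbb C^\times$. For each character $\omega\colon P\to\mathbb C^\times$, define $f_\omega\in\operatorname{Ind}_P^H\omega$ to be the function supported on the matrices of the form $p\begin{bmatrix}0&-1_n\\1_n&0\end{bmatrix}\begin{bmatrix}1_n&B\\0&1_n\end{bmatrix}$ with $p\in P$, $B\in\mathbb F_q^{n\times n}$, with value $$f_\omega\left(p\begin{bmatrix}0&-1_n\\1_n&0\end{bmatrix}\begin{bmatrix}1_n&B\\0&1_n\end{bmatrix}\right)=\omega(p)\psi(\operatorname{tr}B).$$ Then $$Mf_\omega=\Bigg(\sum_{B\in\mathrm{GL}_n(\mathbb F_q)}\omega(\det B)\psi(\operatorname{tr}B)\Bigg)f_{\omega'}.$$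
   Context: $P\subseteq H$ is the subgroup of matrices $\begin{bmatrix}A&B\\0&D\end{bmatrix}$ with $A,B,D\in\mathbb F_q^{n\times n}$, $\det(AD)=1$. $\operatorname{Ind}_P^H\omega$ is the space of functions $f\colon H\to\mathbb C$ with $f(pg)=\omega(p)f(g)$ for $p\in P$, $g\in H$. Every character $\omega$ of $P$ has the form $\begin{bmatrix}A&B\\0&D\end{bmatrix}\mapsto\beta((\det D)^{-1})=\beta(\det A)$ for a unique character $\beta\colon\mathbb F_q^\times\to\mathbb C^\times$; in the expression $\omega(\det B)$ the symbol $\omega$ denotes this $\beta$. The character $\omega'\colon P\to\mathbb C^\times$ is $\omega'\left(\begin{bmatrix}A&B\\0&D\end{bmatrix}\right)=\omega\left(\begin{bmatrix}D&0\\0&A\end{bmatrix}\right)$. The intertwining operator $M\colon\operatorname{Ind}_P^H\omega\to\operatorname{Ind}_P^H\omega'$ is $$Mf(g)=\sum_{B\in\mathbb F_q^{n\times n}}f\left(\begin{bmatrix}0&1_n\\-1_n&0\end{bmatrix}\begin{bmatrix}1_n&B\\0&1_n\end{bmatrix}g\right).$$ *)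

theory Defs
  imports
    "HOL-Library.Cardinality"
    "Jordan_Normal_Form.Matrix"
    "Jordan_Normal_Form.Determinant"
    "Jordan_Normal_Form.VS_Connect"
begin

definition mat_trace :: "'a :: comm_monoid_add mat \<Rightarrow> 'a" where
  "mat_trace A = (\<Sum>i<dim_row A. A $$ (i, i))"

definition SL :: "nat \<Rightarrow> 'a :: comm_ring_1 mat monoid" where
  "SL m = \<lparr>carrier = {g \<in> carrier_mat m m. det g = 1}, mult = (*), one = 1\<^sub>m m\<rparr>"

definition GL :: "nat \<Rightarrow> 'a :: comm_ring_1 mat monoid" where
  "GL n = units_of (ring_mat TYPE('a) n ())"

text \<open>Complex-valued characters of a group, as homomorphisms into the unit group of the complex
  numbers. Only the values on the carrier matter.\<close>

definition characters :: "('g, 'm) monoid_scheme \<Rightarrow> ('g \<Rightarrow> complex) set" where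
  "characters G = hom G (units_of class_ring)"

definition siegel_carrier :: "nat \<Rightarrow> 'a :: comm_ring_1 mat set" where
  "siegel_carrier n = {four_block_mat A B (0\<^sub>m n n) D | A B D.
     A \<in> carrier_mat n n \<and> B \<in> carrier_mat n n \<and> D \<in> carrier_mat n n \<and> det (A * D) = 1}"

definition siegel :: "nat \<Rightarrow> 'a :: comm_ring_1 mat monoid" where
  "siegel n = (SL (2 * n))\<lparr>carrier := siegel_carrier n\<rparr>"

definition unip :: "nat \<Rightarrow> 'a :: comm_ring_1 mat \<Rightarrow> 'a mat" where
  "unip n B = four_block_mat (1\<^sub>m n) B (0\<^sub>m n n) (1\<^sub>m n)"

text \<open>The character of the multiplicative group of the field that corresponds to a character
  of the Siegel parabolic. It is extended by \<open>0\<close> to the whole field to make it unique as a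
  function on the type.\<close>

definition det_character :: "nat \<Rightarrow> ('a :: field mat \<Rightarrow> complex) \<Rightarrow> 'a \<Rightarrow> complex" where
  "det_character n \<omega> = (THE \<beta>. \<beta> \<in> characters (units_of class_ring) \<and> \<beta> 0 = 0 \<and>
     (\<forall>A B D. four_block_mat A B (0\<^sub>m n n) D \<in> siegel_carrier n \<longrightarrow>
        A \<in> carrier_mat n n \<longrightarrow> B \<in> carrier_mat n n \<longrightarrow> D \<in> carrier_mat n n \<longrightarrow>
        \<omega> (four_block_mat A B (0\<^sub>m n n) D) = \<beta> (det A)))"

definition swap_character :: "nat \<Rightarrow> ('a :: comm_ring_1 mat \<Rightarrow> complex) \<Rightarrow> 'a mat \<Rightarrow> complex" where
  "swap_character n \<omega> p =
     (case split_block p n n of (A, B, C, D) \<Rightarrow> \<omega> (four_block_mat D (0\<^sub>m n n) (0\<^sub>m n n) A))"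

text \<open>Functions on the special linear group are represented by functions on the type of all
  matrices that vanish outside the group; this keeps the pointwise vector space structure.\<close>

definition Ind :: "nat \<Rightarrow> ('a :: comm_ring_1 mat \<Rightarrow> complex) \<Rightarrow> ('a mat \<Rightarrow> complex) set" where
  "Ind n \<omega> = {f. (\<forall>g. g \<notin> carrier (SL (2 * n)) \<longrightarrow> f g = 0) \<and>
     (\<forall>p \<in> carrier (siegel n). \<forall>g \<in> carrier (SL (2 * n)). f (p * g) = \<omega> p * f g)}"

definition intertwining :: "nat \<Rightarrow> ('a :: comm_ring_1 mat \<Rightarrow> complex) \<Rightarrow> 'a mat \<Rightarrow> complex" where
  "intertwining n f g = (if g \<in> carrier (SL (2 * n)) then
     (\<Sum>B \<in> carrier_mat n n.
        f (four_block_mat (0\<^sub>m n n) (1\<^sub>m n) (- 1\<^sub>m n) (0\<^sub>m n n) * unip n B * g)) else 0)"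

definition big_cell_elt :: "nat \<Rightarrow> 'a :: comm_ring_1 mat \<Rightarrow> 'a mat \<Rightarrow> 'a mat" where
  "big_cell_elt n p B =
     p * four_block_mat (0\<^sub>m n n) (- 1\<^sub>m n) (1\<^sub>m n) (0\<^sub>m n n) * unip n B"

definition ind_section ::
  "nat \<Rightarrow> ('a :: comm_ring_1 \<Rightarrow> complex) \<Rightarrow> ('a mat \<Rightarrow> complex) \<Rightarrow> 'a mat \<Rightarrow> complex" where
  "ind_section n \<psi> \<omega> = (THE f. f \<in> Ind n \<omega> \<and>
     (\<forall>p \<in> carrier (siegel n). \<forall>B \<in> carrier_mat n n.
        f (big_cell_elt n p B) = \<omega> p * \<psi> (mat_trace B)) \<and>
     (\<forall>g. f g \<noteq> 0 \<longrightarrow> (\<exists>p \<in> carrier (siegel n). \<exists>B \<in> carrier_mat n n. g = big_cell_elt n p B)))"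

end

theory Submission
  imports Defs
begin

text \<open>
  Write \<open>g \<in> SL\<^bsub>2n\<^esub>\<close> in blocks with top row \<open>(a, b)\<close> and bottom row \<open>(c, d)\<close>, and write
  \<open>\<omega>(p) = \<beta>(det A)\<close> for \<open>p \<in> P\<close> with diagonal blocks \<open>A\<close>, \<open>D\<close>. The big cell consists of the \<open>g\<close> with
  \<open>c\<close> invertible, and there
  \<^item> \<open>f\<^sub>\<omega>(g) = \<beta>(det c)\<inverse> \<psi>(tr(c\<inverse> d))\<close> (lemma \<open>ind_section_eq\<close>).

  So \<open>f\<^sub>\<omega>\<close> depends only on the bottom row; the right-hand side is the function
  \<open>bottom_row_section\<close>, abbreviated \<open>F(c, d)\<close> here. It satisfies
  \<open>F(Dc, Dd) = \<beta>(det D)\<inverse> F(c, d)\<close> and \<open>F(c, cB + d) = \<psi>(tr B) F(c, d)\<close>. In these terms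
  \<open>Mf\<^sub>\<omega>(g) = \<Sum>\<^sub>B F(-(a + Bc), -(b + Bd))\<close>.

  On the big cell (\<open>intertwining_sum_big_cell\<close>) take \<open>Y = -(a + Bc)\<close> as the summation variable and put
  \<open>A = a c\<inverse> d - b\<close>. The second argument of \<open>F\<close> is \<open>Y c\<inverse> d + A\<close>, so \<open>\<psi>(tr(c\<inverse> d))\<close> factors out and
  the sum of \<open>F(Y, A)\<close> over invertible \<open>Y\<close> remains. Substituting \<open>Y = A Z\<inverse>\<close> and using
  \<open>det A = (det c)\<inverse>\<close> turns it into \<open>\<beta>(det c)\<close> times the Gauss sum of \<open>\<beta>\<close>. The character \<open>\<omega>'\<close>
  corresponds to \<open>\<beta>\<inverse>\<close>, so this is the Gauss sum times \<open>f\<^bsub>\<omega>'\<^esub>(g)\<close>.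

  Off the big cell (\<open>intertwining_sum_off_big_cell\<close>) \<open>Mf\<^sub>\<omega>\<close> has to vanish. As \<open>c\<close> is singular, there is
  an \<open>N\<close> with \<open>c N = 0\<close> and \<open>\<psi>(tr N) \<noteq> 1\<close>. Right translation of \<open>g\<close> by the unipotent element of
  \<open>N\<close> does not change the bottom row, hence it is also a left translation by an element of \<open>P\<close> with
  diagonal blocks \<open>A\<close>, \<open>1\<close>, where \<open>det A = 1\<close>. The first description multiplies \<open>Mf\<^sub>\<omega>(g)\<close> by
  \<open>\<psi>(tr N)\<close>, the second one leaves it unchanged.

  The existence of \<open>\<beta>\<close> is \<open>siegel_character_factors_through_det\<close>. It rests on the fact that characters of
  the general linear group over a field with more than two elements factor through the determinant
  (\<open>gl_character_factors_through_det\<close>), and on the existence of a scalar \<open>t \<noteq> 0\<close> with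
  \<open>t\<^sup>2 \<noteq> 1\<close>, which is where the hypothesis on \<open>q\<close> enters.
\<close>

section \<open>Inverses, traces and blocks of matrices\<close>

definition mat_inv :: "'a :: field mat \<Rightarrow> 'a mat" where
  "mat_inv A = inverse (det A) \<cdot>\<^sub>m adj_mat A"

lemma mat_inv:
  assumes A: "A \<in> carrier_mat n n"
  shows "mat_inv A \<in> carrier_mat n n"
    and "det A \<noteq> 0 \<Longrightarrow> A * mat_inv A = 1\<^sub>m n" and "det A \<noteq> 0 \<Longrightarrow> mat_inv A * A = 1\<^sub>m n"
proof -
  note adj = adj_mat[OF A]
  show "mat_inv A \<in> carrier_mat n n" unfolding mat_inv_def using adj by simp
  assume "det A \<noteq> 0"
  thus "A * mat_inv A = 1\<^sub>m n" "mat_inv A * A = 1\<^sub>m n"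
    unfolding mat_inv_def mult_smult_distrib[OF A adj(1)] mult_smult_assoc_mat[OF adj(1) A] adj
    by (auto intro!: eq_matI)
qed

lemma mat_inv_unique:
  assumes "A \<in> carrier_mat n n" "det A \<noteq> 0" "X \<in> carrier_mat n n" "A * X = 1\<^sub>m n"
  shows "mat_inv A = X"
proof -
  have "mat_inv A * (A * X) = mat_inv A * A * X"
    using assms mat_inv(1)[OF assms(1)] by (simp add: assoc_mult_mat[of _ n n _ n _ n])
  thus ?thesis using assms mat_inv[OF assms(1)] by simp
qed

lemma mat_inv_mult:
  assumes A: "A \<in> carrier_mat n n" "det A \<noteq> 0" and B: "B \<in> carrier_mat n n" "det B \<noteq> 0"
  shows "mat_inv (A * B) = mat_inv B * mat_inv A"
proof (rule mat_inv_unique)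
  have "A * B * (mat_inv B * mat_inv A) = A * (B * mat_inv B) * mat_inv A"
    using A B mat_inv(1)[OF A(1)] mat_inv(1)[OF B(1)] by (simp add: assoc_mult_mat[of _ n n _ n _ n])
  thus "A * B * (mat_inv B * mat_inv A) = 1\<^sub>m n"
    using A B mat_inv[OF A(1)] mat_inv[OF B(1)] by simp
qed (use assms mat_inv(1)[OF A(1)] mat_inv(1)[OF B(1)] in \<open>auto simp: det_mult[of _ n]\<close>)

lemma det_mat_inv:
  assumes A: "A \<in> carrier_mat n n"
  shows "det A \<noteq> 0 \<Longrightarrow> det (mat_inv A) = inverse (det A)"
proof -
  assume d: "det A \<noteq> 0"
  have "det A * det (mat_inv A) = 1"
    using det_mult[OF A mat_inv(1)[OF A]] mat_inv(2)[OF A d] by simp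
  thus ?thesis by (metis inverse_unique)
qed

lemma mat_trace_add:
  "A \<in> carrier_mat n n \<Longrightarrow> B \<in> carrier_mat n n \<Longrightarrow> mat_trace (A + B) = mat_trace A + mat_trace B"
  unfolding mat_trace_def by (simp add: sum.distrib)

lemma finite_carrier_mat: "finite (carrier_mat nr nc :: 'a :: finite mat set)"
proof (rule finite_subset)
  show "carrier_mat nr nc \<subseteq> mat nr nc ` (({..<nr} \<times> {..<nc}) \<rightarrow>\<^sub>E (UNIV :: 'a set))"
  proof
    fix A :: "'a mat" assume "A \<in> carrier_mat nr nc"
    hence "A = mat nr nc (restrict (($$) A) ({..<nr} \<times> {..<nc}))" by (intro eq_matI) auto
    thus "A \<in> mat nr nc ` (({..<nr} \<times> {..<nc}) \<rightarrow>\<^sub>E UNIV)" by auto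
  qed
qed (auto intro!: finite_PiE)

lemma split_block_four_block_mat:
  assumes "A \<in> carrier_mat r1 c1" "B \<in> carrier_mat r1 c2" "C \<in> carrier_mat r2 c1" "D \<in> carrier_mat r2 c2"
  shows "split_block (four_block_mat A B C D) r1 c1 = (A, B, C, D)"
  using assms unfolding split_block_def Let_def by (auto intro!: eq_matI)

lemma four_block_mat_inject:
  assumes "A \<in> carrier_mat r1 c1" "B \<in> carrier_mat r1 c2" "C \<in> carrier_mat r2 c1" "D \<in> carrier_mat r2 c2"
    "A' \<in> carrier_mat r1 c1" "B' \<in> carrier_mat r1 c2" "C' \<in> carrier_mat r2 c1" "D' \<in> carrier_mat r2 c2"
    "four_block_mat A B C D = four_block_mat A' B' C' D'"
  shows "A = A' \<and> B = B' \<and> C = C' \<and> D = D'"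
  using split_block_four_block_mat[OF assms(1-4), unfolded assms(9) split_block_four_block_mat[OF assms(5-8)]]
  by simp

text \<open>Gaussian elimination by blocks, with the Schur complement of \<open>a\<close> in the middle factor.\<close>

lemma four_block_mat_LDU:
  fixes a :: "'a :: comm_ring_1 mat"
  assumes c: "a \<in> carrier_mat k k" "b \<in> carrier_mat k m" "c \<in> carrier_mat m k" "d \<in> carrier_mat m m"
    and ai: "ai \<in> carrier_mat k k" "a * ai = 1\<^sub>m k" "ai * a = 1\<^sub>m k"
  shows "four_block_mat a b c d =
    four_block_mat (1\<^sub>m k) (0\<^sub>m k m) (c * ai) (1\<^sub>m m) *
    (four_block_mat a (0\<^sub>m k m) (0\<^sub>m m k) (d - c * ai * b) *
     four_block_mat (1\<^sub>m k) (ai * b) (0\<^sub>m m k) (1\<^sub>m m))"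
proof -
  have 1: "a * (ai * b) = b" "c * ai * a = c"
    using c ai
    by (simp_all add: assoc_mult_mat[symmetric, of a k k ai k b m] assoc_mult_mat[of c m k ai k a k])
  have 2: "c * ai * b + (d - c * ai * b) = d"
    using c ai by (intro eq_matI) auto
  have cb: "c * ai * b \<in> carrier_mat m m" "ai * b \<in> carrier_mat k m" "c * ai \<in> carrier_mat m k"
    using c ai by auto
  define S where "S = d - c * ai * b"
  have S: "S \<in> carrier_mat m m" unfolding S_def by (rule minus_carrier_mat[OF cb(1)])
  have "four_block_mat a (0\<^sub>m k m) (0\<^sub>m m k) S * four_block_mat (1\<^sub>m k) (ai * b) (0\<^sub>m m k) (1\<^sub>m m) =
      four_block_mat a b (0\<^sub>m m k) S"
    unfolding mult_four_block_mat[OF c(1) zero_carrier_mat zero_carrier_mat S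
        one_carrier_mat cb(2) zero_carrier_mat one_carrier_mat] 1(1) left_mult_zero_mat[OF cb(2)]
    using c S by simp
  moreover have "four_block_mat (1\<^sub>m k) (0\<^sub>m k m) (c * ai) (1\<^sub>m m) * four_block_mat a b (0\<^sub>m m k) S =
      four_block_mat a b c d"
    unfolding mult_four_block_mat[OF one_carrier_mat zero_carrier_mat cb(3) one_carrier_mat
        c(1,2) zero_carrier_mat S] 1(2)
    using c cb S 2[folded S_def] by simp
  ultimately show ?thesis unfolding S_def by simp
qed

text \<open>A vector \<open>v \<noteq> 0\<close> in the kernel of \<open>c\<close> gives the matrices \<open>v w\<^sup>T\<close>, which \<open>c\<close> annihilates, and
  whose trace \<open>w \<bullet> v\<close> is arbitrary.\<close>

lemma exists_trace_annihilated:
  fixes c :: "'a :: field mat"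
  assumes c: "c \<in> carrier_mat n n" "det c = 0"
  obtains N where "N \<in> carrier_mat n n" "c * N = 0\<^sub>m n n" "mat_trace N = x"
proof -
  obtain v where v: "v \<in> carrier_vec n" "v \<noteq> 0\<^sub>v n" "c *\<^sub>v v = 0\<^sub>v n"
    using det_0_iff_vec_prod_zero_field[OF c(1)] c(2) by blast
  obtain k where k: "k < n" "v $ k \<noteq> 0"
    using v(1,2) by (metis carrier_vecD eq_vecI index_zero_vec)
  \<comment> \<open>\<open>v w\<^sup>T\<close> for the multiple \<open>w\<close> of the \<open>k\<close>-th unit vector with \<open>w \<bullet> v = x\<close>.\<close>
  define N where "N = mat n n (\<lambda>(i, j). if j = k then v $ i * (x / v $ k) else 0)"
  have N: "N \<in> carrier_mat n n" unfolding N_def by simp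
  have "(c * N) $$ (i, j) = 0" if ij: "i < n" "j < n" for i j
  proof -
    have "col N j = (if j = k then x / v $ k else 0) \<cdot>\<^sub>v v"
      using ij v unfolding N_def by (intro eq_vecI) auto
    hence "(c * N) $$ (i, j) = (if j = k then x / v $ k else 0) * (row c i \<bullet> v)"
      using ij c v N by (simp add: scalar_prod_smult_distrib[of _ n])
    also have "row c i \<bullet> v = (c *\<^sub>v v) $ i" using ij c by simp
    finally show ?thesis using v ij by simp
  qed
  hence "c * N = 0\<^sub>m n n" using c N by (intro eq_matI) auto
  moreover have "mat_trace N = (\<Sum>i<n. if i = k then x else 0)"
    unfolding mat_trace_def N_def using k by (intro sum.cong) auto
  hence "mat_trace N = x" using k by simp
  ultimately show ?thesis using that N by blast
qed

section \<open>Characters of the general linear group\<close>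

definition gl_character :: "nat \<Rightarrow> ('a :: field mat \<Rightarrow> complex) \<Rightarrow> bool" where
  "gl_character m \<chi> \<longleftrightarrow>
     (\<forall>A \<in> carrier_mat m m. \<forall>B \<in> carrier_mat m m. det A \<noteq> 0 \<longrightarrow> det B \<noteq> 0 \<longrightarrow>
        \<chi> (A * B) = \<chi> A * \<chi> B) \<and>
     (\<forall>A \<in> carrier_mat m m. det A \<noteq> 0 \<longrightarrow> \<chi> A \<noteq> 0)"

lemma gl_character_mult:
  "gl_character m \<chi> \<Longrightarrow> A \<in> carrier_mat m m \<Longrightarrow> B \<in> carrier_mat m m \<Longrightarrow> det A \<noteq> 0 \<Longrightarrow> det B \<noteq> 0 \<Longrightarrow>
    \<chi> (A * B) = \<chi> A * \<chi> B"
  and gl_character_nonzero: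
  "gl_character m \<chi> \<Longrightarrow> A \<in> carrier_mat m m \<Longrightarrow> det A \<noteq> 0 \<Longrightarrow> \<chi> A \<noteq> 0"
  unfolding gl_character_def by auto

text \<open>Conjugation by the block scalar matrix with blocks \<open>t\<close> and \<open>1\<close> turns the unipotent matrix of \<open>Y\<close> into
  that of \<open>t Y\<close>, the product of those of \<open>Y\<close> and \<open>(t - 1) Y\<close>. A character cannot see the conjugation, so
  it is trivial on the unipotent matrix of \<open>(t - 1) Y\<close>.\<close>

lemma gl_character_upper_unipotent:
  fixes \<chi> :: "'a :: field mat \<Rightarrow> complex"
  assumes \<chi>: "gl_character (k + m) \<chi>"
    and t: "t \<noteq> 0" "t \<noteq> (1 :: 'a)"
    and X: "X \<in> carrier_mat k m"
  shows "\<chi> (four_block_mat (1\<^sub>m k) X (0\<^sub>m m k) (1\<^sub>m m)) = 1"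
proof -
  note mult = gl_character_mult[OF \<chi>]
  note nz = gl_character_nonzero[OF \<chi>]
  define U where "U Y = four_block_mat (1\<^sub>m k) Y (0\<^sub>m m k) (1\<^sub>m m)" for Y :: "'a mat"
  define T where "T = four_block_mat (t \<cdot>\<^sub>m 1\<^sub>m k) (0\<^sub>m k m) (0\<^sub>m m k) (1\<^sub>m m)"
  have U: "U Y \<in> carrier_mat (k + m) (k + m)" "det (U Y) = 1" if "Y \<in> carrier_mat k m" for Y
    using that unfolding U_def by (auto simp: det_four_block_mat_lower_left_zero[of _ k _ m])
  have T: "T \<in> carrier_mat (k + m) (k + m)" "det T \<noteq> 0"
    using t unfolding T_def
    by (auto simp: det_four_block_mat_lower_left_zero[of _ k _ m])
  have add: "U Y * U Z = U (Z + Y)" if "Y \<in> carrier_mat k m" "Z \<in> carrier_mat k m" for Y Z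
    using that unfolding U_def
    by (subst mult_four_block_mat[of _ k k _ m _ m]) auto
  have conj: "T * U Y = U (t \<cdot>\<^sub>m Y) * T" if "Y \<in> carrier_mat k m" for Y
    using that unfolding U_def T_def
    by (subst (1 2) mult_four_block_mat[of _ k k _ m _ m]) (auto intro!: cong_four_block_mat)
  define Y where "Y = inverse (t - 1) \<cdot>\<^sub>m X"
  have Y: "Y \<in> carrier_mat k m" using X unfolding Y_def by auto
  have tY: "t \<cdot>\<^sub>m Y = X + Y"
  proof (rule eq_matI)
    fix i j assume "i < dim_row (X + Y)" "j < dim_col (X + Y)"
    thus "(t \<cdot>\<^sub>m Y) $$ (i, j) = (X + Y) $$ (i, j)"
      using X t unfolding Y_def by (auto simp: field_simps)
  qed (use X Y in auto)
  have "\<chi> T * \<chi> (U Y) = \<chi> (U (t \<cdot>\<^sub>m Y) * T)"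
    using conj[OF Y] mult[OF T(1) U(1)[OF Y]] T U[OF Y] by auto
  also have "\<dots> = \<chi> (U (t \<cdot>\<^sub>m Y)) * \<chi> T"
    using mult U[of "t \<cdot>\<^sub>m Y"] T Y by auto
  also have "U (t \<cdot>\<^sub>m Y) = U Y * U X" using tY add[OF Y X] by simp
  also have "\<chi> \<dots> = \<chi> (U Y) * \<chi> (U X)" using mult U[OF X] U[OF Y] by auto
  finally have "\<chi> (U X) = 1" using nz[OF T] nz[OF U(1)[OF Y]] U(2)[OF Y] by simp
  thus ?thesis unfolding U_def .
qed

lemma gl_character_transpose:
  assumes "gl_character m \<chi>"
  shows "gl_character m (\<lambda>A. \<chi> (transpose_mat A))"
  using assms unfolding gl_character_def
  by (auto simp: transpose_mult[of _ m m _ m] det_transpose)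

lemma gl_character_lower_unipotent:
  fixes \<chi> :: "'a :: field mat \<Rightarrow> complex"
  assumes \<chi>: "gl_character (k + m) \<chi>"
    and t: "t \<noteq> 0" "t \<noteq> (1 :: 'a)"
    and X: "X \<in> carrier_mat m k"
  shows "\<chi> (four_block_mat (1\<^sub>m k) (0\<^sub>m k m) X (1\<^sub>m m)) = 1"
  using gl_character_upper_unipotent[OF gl_character_transpose[OF \<chi>] t, of "transpose_mat X"] X
  by (simp add: transpose_four_block_mat[of _ k k _ m _ m])

text \<open>This conjugacy shows that a character takes the same value on diagonal matrices with the entry \<open>x\<close> in
  the first or in the second place and ones elsewhere.\<close>

lemma swap_diagonal_entries:
  fixes x :: "'a :: field"
  shows "swaprows_mat (Suc (Suc m)) 0 1 * multrow_mat (Suc (Suc m)) 0 x =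
    multrow_mat (Suc (Suc m)) 1 x * swaprows_mat (Suc (Suc m)) 0 1"
  by (subst swaprows_mat[symmetric, where nc = "Suc (Suc m)"], simp_all,
      subst multrow_mat[symmetric, where nc = "Suc (Suc m)"], simp)
     (rule eq_matI, auto)

text \<open>By induction on the size. After left multiplication by a unipotent matrix the upper left entry is
  nonzero, and one elimination step writes the matrix as a product of unipotent matrices and a block
  diagonal matrix with blocks of sizes \<open>1\<close> and \<open>m\<close>. Unipotent matrices do not contribute, and on the block of
  size \<open>m\<close> the induction hypothesis applies. It gives a function \<open>\<gamma>\<close> of the determinant of this block, and
  conjugacy of diagonal matrices identifies \<open>\<gamma>\<close> with the function \<open>\<beta>\<close> that belongs to the first
  diagonal entry.\<close>

lemma gl_character_factors_through_det:
  fixes \<chi> :: "'a :: field mat \<Rightarrow> complex"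
  assumes t: "t \<noteq> 0" "t \<noteq> (1 :: 'a)"
    and \<chi>: "gl_character m \<chi>"
  shows "\<exists>\<beta>. \<forall>A \<in> carrier_mat m m. det A \<noteq> 0 \<longrightarrow> \<chi> A = \<beta> (det A)"
  using \<chi>
proof (induction m arbitrary: \<chi>)
  case 0
  have "A = 1\<^sub>m 0" if "A \<in> carrier_mat 0 0" for A :: "'a mat"
    using that by (intro eq_matI) auto
  hence "\<forall>A \<in> carrier_mat 0 0. \<chi> A = \<chi> (1\<^sub>m 0)" by metis
  thus ?case by (intro exI[of _ "\<lambda>_. \<chi> (1\<^sub>m 0)"]) blast
next
  case (Suc m)
  have \<chi>: "gl_character (1 + m) \<chi>" using Suc.prems by simp
  define dg where "dg a S = four_block_mat a (0\<^sub>m 1 m) (0\<^sub>m m 1) S" for a S :: "'a mat"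
  have dg: "dg a S \<in> carrier_mat (1 + m) (1 + m)" "det (dg a S) = det a * det S"
    if "a \<in> carrier_mat 1 1" "S \<in> carrier_mat m m" for a S
    using that unfolding dg_def
    by (auto simp: det_four_block_mat_lower_left_zero[of _ 1 _ m] simp del: One_nat_def)
  have dg_mult: "dg a S * dg b R = dg (a * b) (S * R)"
    if "a \<in> carrier_mat 1 1" "S \<in> carrier_mat m m" "b \<in> carrier_mat 1 1" "R \<in> carrier_mat m m" for a b S R
    using that unfolding dg_def by (subst mult_four_block_mat[of _ 1 1 _ m _ m]) auto
  have "gl_character m (\<lambda>S. \<chi> (dg (1\<^sub>m 1) S))"
    unfolding gl_character_def
  proof (intro conjI ballI impI)
    fix A B :: "'a mat"
    assume *: "A \<in> carrier_mat m m" "B \<in> carrier_mat m m" "det A \<noteq> 0" "det B \<noteq> 0"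
    have "dg (1\<^sub>m 1) (A * B) = dg (1\<^sub>m 1) A * dg (1\<^sub>m 1) B"
      using * by (subst dg_mult) auto
    thus "\<chi> (dg (1\<^sub>m 1) (A * B)) = \<chi> (dg (1\<^sub>m 1) A) * \<chi> (dg (1\<^sub>m 1) B)"
      using * dg[of "1\<^sub>m 1"] by (simp add: gl_character_mult[OF \<chi>])
  next
    fix A :: "'a mat"
    assume "A \<in> carrier_mat m m" "det A \<noteq> 0"
    thus "\<chi> (dg (1\<^sub>m 1) A) \<noteq> 0" using dg[of "1\<^sub>m 1" A] gl_character_nonzero[OF \<chi>] by simp
  qed
  from Suc.IH[OF this] obtain \<gamma> where
    \<gamma>: "\<And>S. S \<in> carrier_mat m m \<Longrightarrow> det S \<noteq> 0 \<Longrightarrow> \<chi> (dg (1\<^sub>m 1) S) = \<gamma> (det S)" by auto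
  define \<beta> where "\<beta> x = \<chi> (multrow_mat (Suc m) 0 x)" for x
  have first: "dg a (1\<^sub>m m) = multrow_mat (Suc m) 0 (det a)" if "a \<in> carrier_mat 1 1" for a
    using that unfolding dg_def by (intro eq_matI) (auto simp: det_single)
  have \<beta>_mult: "\<beta> (x * y) = \<beta> x * \<beta> y" if "x \<noteq> 0" "y \<noteq> 0" for x y
  proof -
    have "multrow_mat (Suc m) 0 (x * y) = multrow_mat (Suc m) 0 x * multrow_mat (Suc m) 0 y"
      by (subst multrow_mat[symmetric, where nc = "Suc m"], simp) (rule eq_matI, auto)
    thus ?thesis unfolding \<beta>_def using that
      by (simp add: gl_character_mult[OF Suc.prems] det_multrow_mat)
  qed
  have \<gamma>_eq: "\<gamma> (det S) = \<beta> (det S)" if S: "S \<in> carrier_mat m m" "det S \<noteq> 0" for S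
  proof (cases m)
    case 0
    hence "S = 1\<^sub>m m" using S by (intro eq_matI) auto
    thus ?thesis using \<gamma>[OF S] first[of "1\<^sub>m 1"] by (simp add: \<beta>_def)
  next
    case (Suc l)
    let ?sw = "swaprows_mat (Suc m) 0 1 :: 'a mat"
    let ?x = "det S"
    have e: "dg (1\<^sub>m 1) (multrow_mat m 0 ?x) = multrow_mat (Suc m) 1 ?x"
      unfolding dg_def Suc by (intro eq_matI) auto
    have sw: "?sw * multrow_mat (Suc m) 0 ?x = multrow_mat (Suc m) 1 ?x * ?sw"
      unfolding Suc by (rule swap_diagonal_entries)
    have dets: "det ?sw \<noteq> 0" "det (multrow_mat (Suc m) 0 ?x) \<noteq> 0" "det (multrow_mat (Suc m) 1 ?x) \<noteq> 0"
      using S Suc by (simp_all add: det_multrow_mat det_swaprows_mat)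
    have "\<chi> ?sw * \<beta> ?x = \<chi> (multrow_mat (Suc m) 1 ?x) * \<chi> ?sw"
      using sw dets unfolding \<beta>_def
      by (metis gl_character_mult[OF Suc.prems] multrow_mat_carrier swaprows_mat_carrier)
    hence "\<beta> ?x = \<chi> (multrow_mat (Suc m) 1 ?x)"
      using gl_character_nonzero[OF Suc.prems _ dets(1)] by simp
    also have "\<dots> = \<gamma> ?x"
      using \<gamma>[of "multrow_mat m 0 ?x"] S Suc e by (simp add: det_multrow_mat)
    finally show ?thesis ..
  qed
  have diag: "\<chi> (dg a S) = \<beta> (det (dg a S))"
    if "a \<in> carrier_mat 1 1" "S \<in> carrier_mat m m" "det a \<noteq> 0" "det S \<noteq> 0" for a S
  proof -
    have "dg a S = dg a (1\<^sub>m m) * dg (1\<^sub>m 1) S"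
      using that by (subst dg_mult) auto
    hence "\<chi> (dg a S) = \<chi> (dg a (1\<^sub>m m)) * \<chi> (dg (1\<^sub>m 1) S)"
      using that dg[of a "1\<^sub>m m"] dg[of "1\<^sub>m 1" S] by (simp add: gl_character_mult[OF \<chi>])
    thus ?thesis using that \<gamma> \<gamma>_eq first dg(2)[of a S] \<beta>_mult by (simp add: \<beta>_def[symmetric])
  qed
  have pivot: "\<chi> (four_block_mat a b c d) = \<beta> (det (four_block_mat a b c d))"
    if cc: "a \<in> carrier_mat 1 1" "b \<in> carrier_mat 1 m" "c \<in> carrier_mat m 1" "d \<in> carrier_mat m m"
      and nz: "det (four_block_mat a b c d) \<noteq> 0" "det a \<noteq> 0" for a b c d
  proof -
    define ai where "ai = mat_inv a"
    have ai: "ai \<in> carrier_mat 1 1" "a * ai = 1\<^sub>m 1" "ai * a = 1\<^sub>m 1"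
      unfolding ai_def using mat_inv[OF cc(1)] nz by auto
    define L where "L = four_block_mat (1\<^sub>m 1) (0\<^sub>m 1 m) (c * ai) (1\<^sub>m m)"
    define U where "U = four_block_mat (1\<^sub>m 1) (ai * b) (0\<^sub>m m 1) (1\<^sub>m m)"
    define S where "S = d - c * ai * b"
    have S: "S \<in> carrier_mat m m" using cc ai unfolding S_def by auto
    have L: "L \<in> carrier_mat (1 + m) (1 + m)" "det L = 1" "\<chi> L = 1"
      using cc ai gl_character_lower_unipotent[OF \<chi> t, of "c * ai"] unfolding L_def
      by (auto simp: det_four_block_mat_upper_right_zero[of _ 1 _ m] simp del: One_nat_def)
    have U: "U \<in> carrier_mat (1 + m) (1 + m)" "det U = 1" "\<chi> U = 1"
      using cc ai gl_character_upper_unipotent[OF \<chi> t, of "ai * b"] unfolding U_def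
      by (auto simp: det_four_block_mat_lower_left_zero[of _ 1 _ m] simp del: One_nat_def)
    have eq: "four_block_mat a b c d = L * (dg a S * U)"
      unfolding L_def U_def S_def dg_def by (rule four_block_mat_LDU[OF cc ai])
    have dgU: "dg a S * U \<in> carrier_mat (1 + m) (1 + m)" using dg(1)[OF cc(1) S] U(1) by auto
    have det: "det (four_block_mat a b c d) = det (dg a S)" "det (dg a S * U) = det (dg a S)"
      unfolding eq using L U dg(1)[OF cc(1) S] dgU by (simp_all add: det_mult[of _ "1 + m"] del: One_nat_def plus_1_eq_Suc)
    have "\<chi> (four_block_mat a b c d) = \<chi> (dg a S)"
      unfolding eq using gl_character_mult[OF \<chi> L(1) dgU] gl_character_mult[OF \<chi> dg(1)[OF cc(1) S] U(1)]
        det nz L U by simp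
    moreover have "det S \<noteq> 0" using nz det dg(2)[OF cc(1) S] by auto
    ultimately show ?thesis using diag[OF cc(1) S nz(2)] det by simp
  qed
  have "\<chi> A = \<beta> (det A)" if A: "A \<in> carrier_mat (1 + m) (1 + m)" "det A \<noteq> 0" for A
  proof -
    obtain a b c d where "split_block A 1 1 = (a, b, c, d)" by (metis prod_cases4)
    from split_block[OF this, of m m] A
    have cc: "a \<in> carrier_mat 1 1" "b \<in> carrier_mat 1 m" "c \<in> carrier_mat m 1" "d \<in> carrier_mat m m"
      and Aeq: "A = four_block_mat a b c d" by auto
    \<comment> \<open>Row operations make the upper left entry nonzero: as \<open>A\<close> is invertible, its first column is not zero.\<close>
    obtain v where v: "v \<in> carrier_mat 1 m" "det (a + v * c) \<noteq> 0"
    proof (cases "det a = 0")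
      case False
      show ?thesis by (rule that[of "0\<^sub>m 1 m"]) (use cc False in auto)
    next
      case True
      have "c \<noteq> 0\<^sub>m m 1"
      proof
        assume "c = 0\<^sub>m m 1"
        hence "det A = 0" unfolding Aeq using True cc
          by (simp add: det_four_block_mat_lower_left_zero[of _ 1 _ m] del: One_nat_def)
        thus False using A by simp
      qed
      then obtain i where i: "i < m" "c $$ (i, 0) \<noteq> 0"
        using cc(3) by (metis carrier_matD eq_matI index_zero_mat less_one)
      define v where "v = mat 1 m (\<lambda>(_, j). if j = i then 1 else (0 :: 'a))"
      have v: "v \<in> carrier_mat 1 m" unfolding v_def by simp
      have "row v 0 = unit_vec m i" unfolding v_def by (intro eq_vecI) (auto simp: unit_vec_def)
      moreover have "col c 0 \<in> carrier_vec m" using cc(3) by (intro carrier_vecI) simp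
      ultimately have "(v * c) $$ (0, 0) = c $$ (i, 0)"
        using i v cc by (simp add: scalar_prod_left_unit[OF _ i(1)])
      moreover have "a $$ (0, 0) = 0" using True det_single[OF cc(1)] by simp
      ultimately have "det (a + v * c) \<noteq> 0" using i v cc by (simp add: det_single)
      thus ?thesis using v that by blast
    qed
    define U where "U = four_block_mat (1\<^sub>m 1) v (0\<^sub>m m 1) (1\<^sub>m m)"
    have U: "U \<in> carrier_mat (1 + m) (1 + m)" "det U = 1" "\<chi> U = 1"
      using v gl_character_upper_unipotent[OF \<chi> t, of v] unfolding U_def
      by (auto simp: det_four_block_mat_lower_left_zero[of _ 1 _ m] simp del: One_nat_def)
    have UA: "U * A = four_block_mat (a + v * c) (b + v * d) c d"
      unfolding U_def Aeq using v cc by (subst mult_four_block_mat[of _ 1 1 _ m _ m]) auto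
    have detUA: "det (U * A) = det A" using U A by (simp add: det_mult[of _ "1 + m"] del: One_nat_def plus_1_eq_Suc)
    have "\<chi> (U * A) = \<beta> (det (U * A))"
      unfolding UA by (rule pivot) (use v cc A detUA UA in auto)
    thus ?thesis using gl_character_mult[OF \<chi> U(1) A(1)] U A detUA by simp
  qed
  thus ?case by auto
qed

section \<open>Groups and characters in elementary terms\<close>

lemma class_ring_units: "carrier (units_of (class_ring :: 'a :: field ring)) = {x. x \<noteq> 0}"
proof -
  have "\<exists>y. y * x = 1 \<and> x * y = 1" if "x \<noteq> 0" for x :: 'a
    using that by (intro exI[of _ "inverse x"]) simp
  thus ?thesis by (auto simp: units_of_def Units_def)
qed

lemma characters_unitsD:
  assumes "\<beta> \<in> characters (units_of (class_ring :: 'a :: field ring))"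
  shows "x \<noteq> 0 \<Longrightarrow> y \<noteq> 0 \<Longrightarrow> \<beta> (x * y) = \<beta> x * \<beta> y"
    and "x \<noteq> 0 \<Longrightarrow> \<beta> x \<noteq> 0"
  using assms unfolding characters_def hom_def class_ring_units Pi_def
  by (auto simp: units_of_def)

lemma characters_unitsI:
  assumes "\<And>x y. x \<noteq> 0 \<Longrightarrow> y \<noteq> 0 \<Longrightarrow> \<beta> (x * y) = \<beta> x * \<beta> y"
    and "\<And>x. x \<noteq> 0 \<Longrightarrow> \<beta> x \<noteq> 0"
  shows "\<beta> \<in> characters (units_of (class_ring :: 'a :: field ring))"
  using assms unfolding characters_def hom_def class_ring_units Pi_def
  by (auto simp: units_of_def)

lemma characters_units_one:
  assumes "\<beta> \<in> characters (units_of (class_ring :: 'a :: field ring))"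
  shows "\<beta> 1 = 1"
  using characters_unitsD(1)[OF assms, of 1 1] characters_unitsD(2)[OF assms, of 1] by simp

lemma characters_units_inverse:
  assumes "\<beta> \<in> characters (units_of (class_ring :: 'a :: field ring))" "\<beta> 0 = 0"
  shows "\<beta> (inverse x) = inverse (\<beta> x)"
proof (cases "x = 0")
  case False
  have "\<beta> x * \<beta> (inverse x) = 1"
    using characters_unitsD(1)[OF assms(1) False, of "inverse x"] characters_units_one[OF assms(1)] False by simp
  thus ?thesis by (metis inverse_unique)
qed (use assms in simp)

lemma additive_characterD:
  assumes "\<psi> \<in> characters (add_monoid (class_ring :: 'a :: field ring))"
  shows "\<psi> (x + y) = \<psi> x * \<psi> y"
  using assms unfolding characters_def hom_def class_ring_units Pi_def
  by (auto simp: units_of_def)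

lemma siegel_charactersD:
  fixes \<omega> :: "'a :: field mat \<Rightarrow> complex"
  assumes "\<omega> \<in> characters (siegel n)" "p \<in> siegel_carrier n"
  shows "r \<in> siegel_carrier n \<Longrightarrow> \<omega> (p * r) = \<omega> p * \<omega> r" and "\<omega> p \<noteq> 0"
  using assms unfolding characters_def hom_def class_ring_units Pi_def
  by (auto simp: units_of_def siegel_def SL_def)

lemma GL_carrier: "carrier (GL n) = {A \<in> carrier_mat n n. det A \<noteq> (0 :: 'a :: field)}"
proof -
  have "carrier (GL n) = Units (ring_mat TYPE('a) n ())"
    by (simp add: GL_def units_of_def)
  also have "\<dots> = {A \<in> carrier_mat n n. det A \<noteq> (0 :: 'a)}"
  proof (intro equalityI subsetI)
    fix A :: "'a mat" assume A: "A \<in> Units (ring_mat TYPE('a) n ())"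
    hence "A \<in> carrier_mat n n" by (simp add: Units_def ring_mat_simps)
    thus "A \<in> {A \<in> carrier_mat n n. det A \<noteq> 0}" using unit_imp_det_non_zero[OF A] by simp
  qed (simp add: det_non_zero_imp_unit)
  finally show ?thesis .
qed

text \<open>Membership in \<open>P\<close> is defined by the existence of blocks; for given blocks it is a condition on
  determinants, since the determinant of the whole matrix does not depend on how it is cut into blocks.\<close>

lemma siegel_block_iff:
  fixes A :: "'a :: idom mat"
  assumes "A \<in> carrier_mat n n" "B \<in> carrier_mat n n" "D \<in> carrier_mat n n"
  shows "four_block_mat A B (0\<^sub>m n n) D \<in> siegel_carrier n \<longleftrightarrow> det A * det D = 1"
proof
  assume "four_block_mat A B (0\<^sub>m n n) D \<in> siegel_carrier n"
  then obtain A' B' D' where *: "four_block_mat A B (0\<^sub>m n n) D = four_block_mat A' B' (0\<^sub>m n n) D'"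
    "A' \<in> carrier_mat n n" "B' \<in> carrier_mat n n" "D' \<in> carrier_mat n n" "det (A' * D') = 1"
    unfolding siegel_carrier_def by blast
  have "det (four_block_mat A B (0\<^sub>m n n) D) = 1"
    unfolding *(1) using * by (simp add: det_four_block_mat_lower_left_zero[of _ n _ n] det_mult[of _ n])
  thus "det A * det D = 1"
    using assms by (simp add: det_four_block_mat_lower_left_zero[of _ n _ n])
next
  assume "det A * det D = 1"
  thus "four_block_mat A B (0\<^sub>m n n) D \<in> siegel_carrier n"
    unfolding siegel_carrier_def using assms
    by (intro CollectI exI[of _ A] exI[of _ B] exI[of _ D]) (simp add: det_mult[of _ n])
qed

lemma SL_carrier_iff: "g \<in> carrier (SL m) \<longleftrightarrow> g \<in> carrier_mat m m \<and> det g = 1"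
  by (simp add: SL_def)

lemma SL_mult:
  assumes "g \<in> carrier (SL m)" "h \<in> carrier (SL m)"
  shows "g * h \<in> carrier (SL m)"
  using assms by (auto simp: SL_carrier_iff det_mult[of _ m])

lemma SL_blocks:
  assumes "g \<in> carrier (SL (2 * n))"
  obtains a b c d where "a \<in> carrier_mat n n" "b \<in> carrier_mat n n" "c \<in> carrier_mat n n"
    "d \<in> carrier_mat n n" "g = four_block_mat a b c d"
proof -
  obtain a b c d where "split_block g n n = (a, b, c, d)" by (metis prod_cases4)
  from split_block[OF this, of n n] assms that show ?thesis by (auto simp: SL_carrier_iff)
qed

lemma siegel_subset_SL:
  assumes "p \<in> siegel_carrier n"
  shows "p \<in> carrier (SL (2 * n) :: 'a :: idom mat monoid)"
proof -
  obtain A B D where p: "p = four_block_mat A B (0\<^sub>m n n) D"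
    "A \<in> carrier_mat n n" "B \<in> carrier_mat n n" "D \<in> carrier_mat n n" "det (A * D) = 1"
    using assms unfolding siegel_carrier_def by blast
  thus ?thesis
    by (simp add: SL_carrier_iff det_four_block_mat_lower_left_zero[of _ n _ n] det_mult[of _ n] mult_2)
qed

lemma unip_SL: "B \<in> carrier_mat n n \<Longrightarrow> unip n B \<in> carrier (SL (2 * n) :: 'a :: idom mat monoid)"
  unfolding unip_def
  by (simp add: SL_carrier_iff det_four_block_mat_lower_left_zero[of _ n _ n] mult_2)

lemma weyl_SL:
  "four_block_mat (0\<^sub>m n n) (- 1\<^sub>m n) (1\<^sub>m n) (0\<^sub>m n n) \<in> carrier (SL (2 * n) :: 'a :: idom mat monoid)"
  "four_block_mat (0\<^sub>m n n) (1\<^sub>m n) (- 1\<^sub>m n) (0\<^sub>m n n) \<in> carrier (SL (2 * n) :: 'a :: idom mat monoid)"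
proof -
  have "0\<^sub>m n n - - 1\<^sub>m n = (1\<^sub>m n :: 'a mat)" "- 0\<^sub>m n n = (0\<^sub>m n n :: 'a mat)"
    by (intro eq_matI; auto)+
  thus "four_block_mat (0\<^sub>m n n) (- 1\<^sub>m n) (1\<^sub>m n) (0\<^sub>m n n) \<in> carrier (SL (2 * n) :: 'a mat monoid)"
    "four_block_mat (0\<^sub>m n n) (1\<^sub>m n) (- 1\<^sub>m n) (0\<^sub>m n n) \<in> carrier (SL (2 * n) :: 'a mat monoid)"
    by (simp_all add: SL_carrier_iff det_four_block_mat[of _ n] mult_2)
qed

section \<open>Characters of the Siegel parabolic\<close>

text \<open>Otherwise the field is contained in \<open>{0, 1, -1}\<close> and has two or three elements.\<close>

lemma exists_nonzero_square_ne_one: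
  assumes "\<not> 2 dvd CARD('a :: {field, finite})" "\<not> 3 dvd CARD('a)"
  shows "\<exists>t :: 'a. t \<noteq> 0 \<and> t\<^sup>2 \<noteq> 1"
proof (rule ccontr)
  assume "\<not> ?thesis"
  hence "(UNIV :: 'a set) \<subseteq> {0, 1, -1}" by (auto simp: power2_eq_1_iff)
  hence "CARD('a) \<le> card {0, 1, -1 :: 'a}" by (intro card_mono) auto
  also have "\<dots> \<le> 3" by (simp add: card_insert_if)
  finally have "CARD('a) \<le> 3" .
  moreover have "card {0, 1 :: 'a} \<le> CARD('a)" by (intro card_mono) auto
  hence "CARD('a) \<ge> 2" by simp
  ultimately have "CARD('a) = 2 \<or> CARD('a) = 3" by auto
  thus False using assms by auto
qed

text \<open>The scalar element with diagonal blocks \<open>t\<close> and \<open>t\<inverse>\<close> multiplies the upper right block of a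
  unipotent element by \<open>t\<^sup>2\<close> under conjugation, so \<open>\<omega>\<close> is trivial on the unipotent radical if
  \<open>t\<^sup>2 \<noteq> 1\<close>. On the Levi subgroup the two blocks are linked by \<open>det A det D = 1\<close>. To obtain characters of
  the full group \<open>GL\<^sub>n\<close>, one block is allowed to be arbitrary, and a diagonal matrix with at most one entry
  different from \<open>1\<close> in the other block compensates its determinant.\<close>

lemma siegel_character_factors_through_det:
  fixes \<omega> :: "'a :: field mat \<Rightarrow> complex"
  assumes n: "n \<ge> 1"
    and t: "t \<noteq> 0" "t\<^sup>2 \<noteq> (1 :: 'a)"
    and \<omega>: "\<omega> \<in> characters (siegel n)"
  obtains \<beta> where "\<beta> \<in> characters (units_of class_ring)" "\<beta> 0 = 0"
    "\<And>A B D. A \<in> carrier_mat n n \<Longrightarrow> B \<in> carrier_mat n n \<Longrightarrow> D \<in> carrier_mat n n \<Longrightarrow>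
       det A * det D = 1 \<Longrightarrow> \<omega> (four_block_mat A B (0\<^sub>m n n) D) = \<beta> (det A)"
proof -
  define P where "P A B D = four_block_mat A B (0\<^sub>m n n) D" for A B D :: "'a mat"
  have P_mult: "P A B D * P A' B' D' = P (A * A') (A * B' + B * D') (D * D')"
    if "A \<in> carrier_mat n n" "B \<in> carrier_mat n n" "D \<in> carrier_mat n n"
      "A' \<in> carrier_mat n n" "B' \<in> carrier_mat n n" "D' \<in> carrier_mat n n" for A B D A' B' D'
    unfolding P_def using that by (subst mult_four_block_mat[of _ n n _ n _ n]) auto
  have P_nz: "\<omega> (P A B D) \<noteq> 0"
    if "A \<in> carrier_mat n n" "B \<in> carrier_mat n n" "D \<in> carrier_mat n n" "det A * det D = 1" for A B D
    using siegel_charactersD(2)[OF \<omega>] siegel_block_iff that unfolding P_def by metis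
  have \<omega>_mult: "\<omega> (P (A * A') (A * B' + B * D') (D * D')) = \<omega> (P A B D) * \<omega> (P A' B' D')"
    if "A \<in> carrier_mat n n" "B \<in> carrier_mat n n" "D \<in> carrier_mat n n" "det A * det D = 1"
      "A' \<in> carrier_mat n n" "B' \<in> carrier_mat n n" "D' \<in> carrier_mat n n" "det A' * det D' = 1"
    for A B D A' B' D'
    using P_mult[OF that(1-3,5-7)] siegel_charactersD(1)[OF \<omega>] siegel_block_iff that
    unfolding P_def by metis
  let ?O = "0\<^sub>m n n :: 'a mat" and ?I = "1\<^sub>m n :: 'a mat"
  let ?\<delta> = "multrow_mat n 0 :: 'a \<Rightarrow> 'a mat"
  have [simp]: "det (?\<delta> x) = x" for x using n by (simp add: det_multrow_mat)
  have \<delta>_mult: "?\<delta> x * ?\<delta> y = ?\<delta> (x * y)" for x y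
    by (subst multrow_mat[symmetric, where nc = n], simp) (rule eq_matI, auto)

  have unip: "\<omega> (P ?I X ?I) = 1" if X: "X \<in> carrier_mat n n" for X
  proof -
    \<comment> \<open>Chosen such that \<open>t\<^sup>2 Y = X + Y\<close>.\<close>
    define Y where "Y = inverse (t\<^sup>2 - 1) \<cdot>\<^sub>m X"
    have Y: "Y \<in> carrier_mat n n" using X unfolding Y_def by auto
    let ?t = "t \<cdot>\<^sub>m ?I" and ?t' = "inverse t \<cdot>\<^sub>m ?I"
    have dt: "det ?t * det ?t' = 1" using t by (simp add: power_mult_distrib[symmetric])
    have Z: "?t * Y = (X + Y) * ?t'"
    proof (rule eq_matI)
      have 1: "?t * Y = t \<cdot>\<^sub>m Y" "(X + Y) * ?t' = inverse t \<cdot>\<^sub>m (X + Y)"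
        using X Y by (auto simp: mult_smult_distrib[of _ n n _ n])
      fix i j assume "i < dim_row ((X + Y) * ?t')" "j < dim_col ((X + Y) * ?t')"
      moreover have "t * (inverse (t\<^sup>2 - 1) * x) = inverse t * (x + inverse (t\<^sup>2 - 1) * x)" for x
        using t by (simp add: field_simps power2_eq_square)
      ultimately show "(?t * Y) $$ (i, j) = ((X + Y) * ?t') $$ (i, j)"
        unfolding 1 using X unfolding Y_def by simp
    qed (use X Y in auto)
    have W: "(X + Y) * ?t' \<in> carrier_mat n n" using X Y by (intro mult_carrier_mat) auto
    have YX: "P ?I (X + Y) ?I = P (?I * ?I) (?I * Y + X * ?I) (?I * ?I)"
      using X Y by (simp add: comm_add_mat[of X n n Y])
    have "\<omega> (P ?t ?O ?t') * \<omega> (P ?I Y ?I) = \<omega> (P (?t * ?I) (?t * Y + ?O * ?I) (?t' * ?I))"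
      using Y dt by (subst \<omega>_mult) auto
    also have "P (?t * ?I) (?t * Y + ?O * ?I) (?t' * ?I)
        = P (?I * ?t) (?I * ?O + (X + Y) * ?t') (?I * ?t')"
      using X Y Z right_add_zero_mat[OF W] left_add_zero_mat[OF W] by simp
    also have "\<omega> \<dots> = \<omega> (P ?I (X + Y) ?I) * \<omega> (P ?t ?O ?t')"
      using X Y dt by (subst \<omega>_mult) auto
    also have "\<omega> (P ?I (X + Y) ?I) = \<omega> (P ?I X ?I) * \<omega> (P ?I Y ?I)"
      unfolding YX using X Y by (subst \<omega>_mult) auto
    finally show ?thesis
      using P_nz[of ?t ?O ?t'] P_nz[of ?I Y ?I] Y dt by simp
  qed

  \<comment> \<open>The characters of \<open>GL\<^sub>n\<close> on the upper and on the lower diagonal block.\<close>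
  define \<chi> where "\<chi> A = \<omega> (P A ?O (?\<delta> (inverse (det A))))" for A
  define \<chi>' where "\<chi>' D = \<omega> (P (?\<delta> (inverse (det D))) ?O D)" for D
  have "gl_character n \<chi>"
    unfolding gl_character_def
  proof (intro conjI ballI impI)
    fix A B :: "'a mat"
    assume *: "A \<in> carrier_mat n n" "B \<in> carrier_mat n n" "det A \<noteq> 0" "det B \<noteq> 0"
    have "P (A * B) ?O (?\<delta> (inverse (det (A * B)))) = P (A * B) (A * ?O + ?O * ?\<delta> (inverse (det B)))
        (?\<delta> (inverse (det A)) * ?\<delta> (inverse (det B)))"
      using * by (simp add: \<delta>_mult det_mult[of _ n])
    thus "\<chi> (A * B) = \<chi> A * \<chi> B"
      unfolding \<chi>_def using * by (simp only:) (subst \<omega>_mult, auto)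
  qed (unfold \<chi>_def, rule P_nz, auto)
  moreover have "t \<noteq> 1" using t by auto
  ultimately obtain \<beta> where \<beta>: "\<And>A. A \<in> carrier_mat n n \<Longrightarrow> det A \<noteq> 0 \<Longrightarrow> \<chi> A = \<beta> (det A)"
    using gl_character_factors_through_det[OF t(1)] by blast
  have "gl_character n \<chi>'"
    unfolding gl_character_def
  proof (intro conjI ballI impI)
    fix A B :: "'a mat"
    assume *: "A \<in> carrier_mat n n" "B \<in> carrier_mat n n" "det A \<noteq> 0" "det B \<noteq> 0"
    have "P (?\<delta> (inverse (det (A * B)))) ?O (A * B) = P (?\<delta> (inverse (det A)) * ?\<delta> (inverse (det B)))
        (?\<delta> (inverse (det A)) * ?O + ?O * B) (A * B)"
      using * by (simp add: \<delta>_mult det_mult[of _ n])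
    thus "\<chi>' (A * B) = \<chi>' A * \<chi>' B"
      unfolding \<chi>'_def using * by (simp only:) (subst \<omega>_mult, auto)
  qed (unfold \<chi>'_def, rule P_nz, auto)
  with \<open>t \<noteq> 1\<close> obtain \<gamma> where \<gamma>: "\<And>A. A \<in> carrier_mat n n \<Longrightarrow> det A \<noteq> 0 \<Longrightarrow> \<chi>' A = \<gamma> (det A)"
    using gl_character_factors_through_det[OF t(1)] by blast
  have \<delta>_one: "?\<delta> 1 = ?I" by (intro eq_matI) auto
  have \<gamma>_one: "\<gamma> 1 = 1"
    using \<gamma>[of ?I] unip[of ?O] by (simp add: \<chi>'_def \<delta>_one)
  have main: "\<omega> (P A B D) = \<beta> (det A)"
    if c: "A \<in> carrier_mat n n" "B \<in> carrier_mat n n" "D \<in> carrier_mat n n" and d: "det A * det D = 1"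
    for A B D
  proof -
    let ?x = "det A"
    have nz: "?x \<noteq> 0" "det D \<noteq> 0" and dD: "det D = inverse ?x"
      using d inverse_unique[OF d] by auto
    have Di: "mat_inv D \<in> carrier_mat n n" "mat_inv D * D = ?I" using mat_inv[OF c(3)] nz by auto
    \<comment> \<open>Split off the unipotent radical, then write the Levi part as a product of an element that
      \<open>\<chi>\<close> sees and one whose diagonal blocks are \<open>1\<close> and a matrix of determinant \<open>1\<close>.\<close>
    have "B * mat_inv D * D = B" using c Di by (simp add: assoc_mult_mat[of _ n n _ n _ n])
    hence "P A B D = P (?I * A) (?I * ?O + B * mat_inv D * D) (?I * D)"
      using c by simp
    also have "\<omega> \<dots> = \<omega> (P ?I (B * mat_inv D) ?I) * \<omega> (P A ?O D)"
      using c Di d by (subst \<omega>_mult) auto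
    also have "\<dots> = \<omega> (P A ?O D)" using unip c Di by simp
    also have "?\<delta> (inverse ?x) * (?\<delta> ?x * D) = ?\<delta> (inverse ?x) * ?\<delta> ?x * D"
      using c by (simp add: assoc_mult_mat[of _ n n _ n _ n])
    hence "P A ?O D = P (A * ?I) (A * ?O + ?O * (?\<delta> ?x * D)) (?\<delta> (inverse ?x) * (?\<delta> ?x * D))"
      using c nz \<delta>_mult[of "inverse ?x" ?x] \<delta>_one by simp
    also have "\<omega> \<dots> = \<omega> (P A ?O (?\<delta> (inverse ?x))) * \<omega> (P ?I ?O (?\<delta> ?x * D))"
      using c nz d by (subst \<omega>_mult) (auto simp: det_mult[of _ n])
    also have "\<omega> (P ?I ?O (?\<delta> ?x * D)) = \<chi>' (?\<delta> ?x * D)"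
      unfolding \<chi>'_def using c d \<delta>_one by (simp add: det_mult[of _ n])
    also have "\<dots> = 1"
      using \<gamma>[of "?\<delta> ?x * D"] c d \<gamma>_one mult_carrier_mat[OF multrow_mat_carrier c(3)]
      by (simp add: det_mult[of _ n])
    finally show ?thesis using \<beta>[OF c(1) nz(1)] by (simp add: \<chi>_def)
  qed
  \<comment> \<open>A character of the unit group leaves the value at \<open>0\<close> open; it is normalised to \<open>0\<close>.\<close>
  define \<beta>' where "\<beta>' x = (if x = 0 then 0 else \<beta> x)" for x
  have \<beta>\<delta>: "\<beta> x = \<omega> (P (?\<delta> x) ?O (?\<delta> (inverse x)))" if "x \<noteq> 0" for x
    using main[of "?\<delta> x" ?O "?\<delta> (inverse x)"] that by simp
  have "\<beta> (x * y) = \<beta> x * \<beta> y" if "x \<noteq> 0" "y \<noteq> 0" for x y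
  proof -
    have "\<beta> (x * y) = \<omega> (P (?\<delta> x * ?\<delta> y) (?\<delta> x * ?O + ?O * ?\<delta> (inverse y)) (?\<delta> (inverse x) * ?\<delta> (inverse y)))"
      using that by (simp add: \<delta>_mult \<beta>\<delta>)
    thus ?thesis using that by (subst (asm) \<omega>_mult) (auto simp: \<beta>\<delta>)
  qed
  moreover have "\<beta> x \<noteq> 0" if "x \<noteq> 0" for x
    using that \<beta>\<delta> P_nz[of "?\<delta> x" ?O "?\<delta> (inverse x)"] by simp
  ultimately have "\<beta>' \<in> characters (units_of class_ring)"
    by (intro characters_unitsI) (auto simp: \<beta>'_def)
  moreover have "\<omega> (four_block_mat A B (0\<^sub>m n n) D) = \<beta>' (det A)"
    if "A \<in> carrier_mat n n" "B \<in> carrier_mat n n" "D \<in> carrier_mat n n" "det A * det D = 1" for A B D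
    using main[OF that] that(4) by (auto simp: P_def \<beta>'_def)
  ultimately show ?thesis by (intro that[of \<beta>']) (auto simp: \<beta>'_def)
qed

text \<open>Uniqueness holds because \<open>n \<ge> 1\<close>: every unit is the determinant of the upper diagonal block of some
  element of \<open>P\<close>.\<close>

lemma det_character_eq:
  fixes \<beta> :: "'a :: field \<Rightarrow> complex"
  assumes n: "n \<ge> 1"
    and \<beta>: "\<beta> \<in> characters (units_of class_ring)" "\<beta> 0 = 0"
    and \<omega>: "\<And>A B D. A \<in> carrier_mat n n \<Longrightarrow> B \<in> carrier_mat n n \<Longrightarrow> D \<in> carrier_mat n n \<Longrightarrow>
       det A * det D = 1 \<Longrightarrow> \<omega> (four_block_mat A B (0\<^sub>m n n) D) = \<beta> (det A)"
  shows "det_character n \<omega> = \<beta>"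
  unfolding det_character_def
proof (rule the_equality)
  show "\<beta> \<in> characters (units_of class_ring) \<and> \<beta> 0 = 0 \<and>
     (\<forall>A B D. four_block_mat A B (0\<^sub>m n n) D \<in> siegel_carrier n \<longrightarrow>
        A \<in> carrier_mat n n \<longrightarrow> B \<in> carrier_mat n n \<longrightarrow> D \<in> carrier_mat n n \<longrightarrow>
        \<omega> (four_block_mat A B (0\<^sub>m n n) D) = \<beta> (det A))"
    using \<beta> \<omega> by (intro conjI allI impI) (simp_all add: siegel_block_iff)
next
  fix \<gamma> :: "'a \<Rightarrow> complex"
  assume \<gamma>: "\<gamma> \<in> characters (units_of class_ring) \<and> \<gamma> 0 = 0 \<and>
     (\<forall>A B D. four_block_mat A B (0\<^sub>m n n) D \<in> siegel_carrier n \<longrightarrow>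
        A \<in> carrier_mat n n \<longrightarrow> B \<in> carrier_mat n n \<longrightarrow> D \<in> carrier_mat n n \<longrightarrow>
        \<omega> (four_block_mat A B (0\<^sub>m n n) D) = \<gamma> (det A))"
  show "\<gamma> = \<beta>"
  proof
    fix x :: 'a
    let ?A = "multrow_mat n 0 x" and ?D = "multrow_mat n 0 (inverse x)"
    show "\<gamma> x = \<beta> x"
    proof (cases "x = 0")
      case False
      have d: "det ?A = x" "det ?D = inverse x" using n by (simp_all add: det_multrow_mat)
      have "four_block_mat ?A (0\<^sub>m n n) (0\<^sub>m n n) ?D \<in> siegel_carrier n"
        using False d by (simp add: siegel_block_iff)
      hence "\<omega> (four_block_mat ?A (0\<^sub>m n n) (0\<^sub>m n n) ?D) = \<gamma> x" using \<gamma> d by auto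
      thus ?thesis using \<omega>[of ?A "0\<^sub>m n n" ?D] False d by simp
    qed (use \<gamma> \<beta> in simp)
  qed
qed

section \<open>Sections supported on the big cell\<close>

text \<open>If \<open>\<beta> 0 = 0\<close>, this vanishes for singular \<open>c\<close>, so that no case distinction is needed to describe
  functions supported on the big cell.\<close>

definition bottom_row_section :: "('a :: field \<Rightarrow> complex) \<Rightarrow> ('a \<Rightarrow> complex) \<Rightarrow> 'a mat \<Rightarrow> 'a mat \<Rightarrow> complex" where
  "bottom_row_section \<psi> \<beta> c d = inverse (\<beta> (det c)) * \<psi> (mat_trace (mat_inv c * d))"

lemma bottom_row_section_left:
  assumes \<beta>: "\<beta> \<in> characters (units_of class_ring)" "\<beta> 0 = 0"
    and D: "D \<in> carrier_mat n n" "det D \<noteq> 0"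
    and c: "c \<in> carrier_mat n n" and d: "d \<in> carrier_mat n n"
  shows "bottom_row_section \<psi> \<beta> (D * c) (D * d) = inverse (\<beta> (det D)) * bottom_row_section \<psi> \<beta> c d"
proof (cases "det c = 0")
  case False
  note Di = mat_inv[OF D(1)] and ci = mat_inv[OF c]
  have "mat_inv (D * c) * (D * d) = mat_inv c * (mat_inv D * D) * d"
    using c d D Di(1) ci(1) False by (simp add: mat_inv_mult assoc_mult_mat[of _ n n _ n _ n])
  hence "mat_inv (D * c) * (D * d) = mat_inv c * d"
    using Di(3)[OF D(2)] ci(1) by simp
  thus ?thesis
    using characters_unitsD(1)[OF \<beta>(1) D(2) False] D c
    by (simp add: bottom_row_section_def det_mult[of _ n])
qed (use assms in \<open>simp add: bottom_row_section_def det_mult[of _ n]\<close>)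

lemma bottom_row_section_right:
  assumes \<beta>: "\<beta> 0 = 0" and \<psi>: "\<psi> \<in> characters (add_monoid class_ring)"
    and c: "c \<in> carrier_mat n n" "d \<in> carrier_mat n n" "B \<in> carrier_mat n n"
  shows "bottom_row_section \<psi> \<beta> c (c * B + d) = \<psi> (mat_trace B) * bottom_row_section \<psi> \<beta> c d"
proof (cases "det c = 0")
  case False
  note ci = mat_inv[OF c(1)]
  have "mat_inv c * (c * B + d) = mat_inv c * (c * B) + mat_inv c * d"
    using c ci(1) by (intro mult_add_distrib_mat[of _ n n]) auto
  also have "mat_inv c * (c * B) = B"
    using c ci False by (simp add: assoc_mult_mat[of _ n n _ n _ n, symmetric])
  finally have "\<psi> (mat_trace (mat_inv c * (c * B + d))) = \<psi> (mat_trace B) * \<psi> (mat_trace (mat_inv c * d))"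
    using c ci(1) by (simp add: mat_trace_add[of _ n] additive_characterD[OF \<psi>])
  thus ?thesis by (simp add: bottom_row_section_def)
qed (use assms in \<open>simp add: bottom_row_section_def\<close>)

text \<open>A closed form of the functions \<open>f\<^sub>\<omega>\<close>.\<close>

definition siegel_section ::
    "nat \<Rightarrow> ('a :: field \<Rightarrow> complex) \<Rightarrow> ('a \<Rightarrow> complex) \<Rightarrow> 'a mat \<Rightarrow> complex" where
  "siegel_section n \<psi> \<beta> g = (if g \<in> carrier (SL (2 * n)) then
     (case split_block g n n of (a, b, c, d) \<Rightarrow> bottom_row_section \<psi> \<beta> c d) else 0)"

lemma siegel_section_block:
  assumes "a \<in> carrier_mat n n" "b \<in> carrier_mat n n" "c \<in> carrier_mat n n" "d \<in> carrier_mat n n"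
    and "four_block_mat a b c d \<in> carrier (SL (2 * n))"
  shows "siegel_section n \<psi> \<beta> (four_block_mat a b c d) = bottom_row_section \<psi> \<beta> c d"
  using assms by (simp add: siegel_section_def split_block_four_block_mat)

lemma big_cell_elt_blocks:
  fixes A :: "'a :: comm_ring_1 mat"
  assumes c: "A \<in> carrier_mat n n" "X \<in> carrier_mat n n" "D \<in> carrier_mat n n" "B \<in> carrier_mat n n"
  shows "big_cell_elt n (four_block_mat A X (0\<^sub>m n n) D) B = four_block_mat X (X * B - A) D (D * B)"
proof -
  have "four_block_mat A X (0\<^sub>m n n) D * four_block_mat (0\<^sub>m n n) (- 1\<^sub>m n) (1\<^sub>m n) (0\<^sub>m n n)
      = four_block_mat X (- A) D (0\<^sub>m n n)"
    using c by (subst mult_four_block_mat[of _ n n _ n _ n]) (auto intro!: cong_four_block_mat)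
  moreover have "four_block_mat X (- A) D (0\<^sub>m n n) * four_block_mat (1\<^sub>m n) B (0\<^sub>m n n) (1\<^sub>m n)
      = four_block_mat X (X * B - A) D (D * B)"
    using c by (subst mult_four_block_mat[of _ n n _ n _ n])
      (auto intro!: cong_four_block_mat simp: add_uminus_minus_mat[of _ n n])
  ultimately show ?thesis by (simp add: big_cell_elt_def unip_def)
qed

lemma big_cell_elt_SL:
  assumes "p \<in> siegel_carrier n" "B \<in> carrier_mat n n"
  shows "big_cell_elt n p B \<in> carrier (SL (2 * n) :: 'a :: idom mat monoid)"
  unfolding big_cell_elt_def
  using assms by (intro SL_mult siegel_subset_SL unip_SL weyl_SL)

text \<open>Comparing blocks with \<open>big_cell_elt_blocks\<close> leaves no choice for \<open>p\<close> and \<open>B\<close>. Only \<open>det p = 1\<close>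
  remains to be seen, and it follows from \<open>det g = 1\<close>, since the other factors have determinant \<open>1\<close>.\<close>

lemma in_big_cell:
  fixes a :: "'a :: field mat"
  assumes c: "a \<in> carrier_mat n n" "b \<in> carrier_mat n n" "c \<in> carrier_mat n n" "d \<in> carrier_mat n n"
    and g: "four_block_mat a b c d \<in> carrier (SL (2 * n))" and nz: "det c \<noteq> 0"
  shows "four_block_mat (a * (mat_inv c * d) - b) a (0\<^sub>m n n) c \<in> siegel_carrier n"
    and "four_block_mat a b c d =
      big_cell_elt n (four_block_mat (a * (mat_inv c * d) - b) a (0\<^sub>m n n) c) (mat_inv c * d)"
proof -
  note ci = mat_inv[OF c(3)]
  define B where "B = mat_inv c * d"
  have B: "B \<in> carrier_mat n n" "c * B = d"
    unfolding B_def using c ci nz by (auto simp: assoc_mult_mat[of _ n n _ n _ n, symmetric])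
  define A where "A = a * B - b"
  have A: "A \<in> carrier_mat n n" unfolding A_def using c by (intro minus_carrier_mat) auto
  have "a * B - A = b" unfolding A_def using c B by (intro eq_matI) auto
  hence eq: "four_block_mat a b c d = big_cell_elt n (four_block_mat A a (0\<^sub>m n n) c) B"
    using big_cell_elt_blocks[OF A c(1,3) B(1)] B by simp
  thus "four_block_mat a b c d =
      big_cell_elt n (four_block_mat (a * (mat_inv c * d) - b) a (0\<^sub>m n n) c) (mat_inv c * d)"
    unfolding A_def B_def .
  let ?p = "four_block_mat A a (0\<^sub>m n n) c"
  have p: "?p \<in> carrier_mat (2 * n) (2 * n)" using A c by (simp add: mult_2)
  have "det (big_cell_elt n ?p B) = det ?p"
    using p weyl_SL(1)[where 'a = 'a, of n] unip_SL[OF B(1)]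
    unfolding big_cell_elt_def by (simp add: SL_carrier_iff det_mult[of _ "2 * n"])
  hence "det ?p = 1" using g eq by (simp add: SL_carrier_iff)
  hence "det A * det c = 1"
    using A c by (simp add: det_four_block_mat_lower_left_zero[of _ n _ n])
  thus "four_block_mat (a * (mat_inv c * d) - b) a (0\<^sub>m n n) c \<in> siegel_carrier n"
    using A c by (simp add: siegel_block_iff A_def B_def)
qed

text \<open>The closed form belongs to the induced representation because it transforms by \<open>\<beta>(det D)\<inverse> = \<beta>(det A)\<close>
  under \<open>P\<close>, and it has the required values on the big cell and support there. These values and the support
  determine a function, which is the uniqueness that the definite description needs.\<close>

lemma ind_section_eq:
  fixes \<beta> :: "'a :: field \<Rightarrow> complex"
  assumes \<beta>: "\<beta> \<in> characters (units_of class_ring)" "\<beta> 0 = 0"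
    and \<psi>: "\<psi> \<in> characters (add_monoid class_ring)"
    and \<omega>: "\<And>A B D. A \<in> carrier_mat n n \<Longrightarrow> B \<in> carrier_mat n n \<Longrightarrow> D \<in> carrier_mat n n \<Longrightarrow>
       det A * det D = 1 \<Longrightarrow> \<omega> (four_block_mat A B (0\<^sub>m n n) D) = \<beta> (det A)"
  shows "ind_section n \<psi> \<omega> = siegel_section n \<psi> \<beta>"
proof -
  let ?f = "siegel_section n \<psi> \<beta>"
  have siegel: "carrier (siegel n :: 'a mat monoid) = siegel_carrier n" by (simp add: siegel_def)
  have \<beta>_inv: "inverse (\<beta> (det D)) = \<beta> (det A)" if "det A * det D = 1" for A D :: "'a mat"
    using characters_units_inverse[OF \<beta>, of "det D"] that
    by (metis inverse_unique mult.commute)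
  have "?f (p * g) = \<omega> p * ?f g" if p: "p \<in> siegel_carrier n" and g: "g \<in> carrier (SL (2 * n))" for p g
  proof -
    obtain A X D where p': "p = four_block_mat A X (0\<^sub>m n n) D" and
      P: "A \<in> carrier_mat n n" "X \<in> carrier_mat n n" "D \<in> carrier_mat n n"
      using p unfolding siegel_carrier_def by blast
    have AD: "det A * det D = 1" using p siegel_block_iff[OF P] unfolding p' by simp
    obtain a b c d where G: "a \<in> carrier_mat n n" "b \<in> carrier_mat n n" "c \<in> carrier_mat n n"
      "d \<in> carrier_mat n n" and g': "g = four_block_mat a b c d" using SL_blocks[OF g] .
    have pg: "p * g = four_block_mat (A * a + X * c) (A * b + X * d) (D * c) (D * d)"
      unfolding p' g' using P G by (subst mult_four_block_mat[of _ n n _ n _ n]) auto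
    have "?f (p * g) = bottom_row_section \<psi> \<beta> (D * c) (D * d)"
      unfolding pg by (rule siegel_section_block)
        (use P G SL_mult[OF siegel_subset_SL[OF p] g] in \<open>auto simp: pg\<close>)
    also have "\<dots> = inverse (\<beta> (det D)) * bottom_row_section \<psi> \<beta> c d"
      by (rule bottom_row_section_left[OF \<beta> P(3) _ G(3,4)]) (use AD in auto)
    also have "inverse (\<beta> (det D)) = \<omega> p"
      unfolding p' using \<omega>[OF P AD] \<beta>_inv[OF AD] by simp
    also have "bottom_row_section \<psi> \<beta> c d = ?f g"
      unfolding g' using siegel_section_block[OF G] g g' by simp
    finally show ?thesis .
  qed
  hence Ind: "?f \<in> Ind n \<omega>" unfolding Ind_def siegel by (auto simp: siegel_section_def)
  have val: "?f (big_cell_elt n p B) = \<omega> p * \<psi> (mat_trace B)"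
    if p: "p \<in> siegel_carrier n" and B: "B \<in> carrier_mat n n" for p B
  proof -
    obtain A X D where p': "p = four_block_mat A X (0\<^sub>m n n) D" and
      P: "A \<in> carrier_mat n n" "X \<in> carrier_mat n n" "D \<in> carrier_mat n n"
      using p unfolding siegel_carrier_def by blast
    have AD: "det A * det D = 1" using p siegel_block_iff[OF P] unfolding p' by simp
    have eq: "big_cell_elt n p B = four_block_mat X (X * B - A) D (D * B)"
      unfolding p' by (rule big_cell_elt_blocks[OF P B])
    have Dnz: "det D \<noteq> 0" using AD by auto
    have XBA: "X * B - A \<in> carrier_mat n n" using P B by (intro minus_carrier_mat) auto
    have "?f (big_cell_elt n p B) = bottom_row_section \<psi> \<beta> D (D * B)"
      unfolding eq by (rule siegel_section_block)
        (use P B XBA big_cell_elt_SL[OF p B] in \<open>auto simp: eq\<close>)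
    also have "mat_inv D * (D * B) = B"
      using mat_inv[OF P(3)] P B Dnz by (simp add: assoc_mult_mat[of _ n n _ n _ n, symmetric])
    hence "bottom_row_section \<psi> \<beta> D (D * B) = inverse (\<beta> (det D)) * \<psi> (mat_trace B)"
      by (simp add: bottom_row_section_def)
    also have "inverse (\<beta> (det D)) = \<omega> p"
      unfolding p' using \<omega>[OF P AD] \<beta>_inv[OF AD] by simp
    finally show ?thesis .
  qed
  have supp: "\<exists>p \<in> siegel_carrier n. \<exists>B \<in> carrier_mat n n. g = big_cell_elt n p B" if "?f g \<noteq> 0" for g
  proof -
    have g: "g \<in> carrier (SL (2 * n))" using that by (auto simp: siegel_section_def split: if_splits)
    obtain a b c d where G: "a \<in> carrier_mat n n" "b \<in> carrier_mat n n" "c \<in> carrier_mat n n"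
      "d \<in> carrier_mat n n" and g': "g = four_block_mat a b c d" using SL_blocks[OF g] .
    have "det c \<noteq> 0"
      using that siegel_section_block[OF G] g \<beta> unfolding g' by (auto simp: bottom_row_section_def)
    from in_big_cell[OF G _ this] g show ?thesis
      unfolding g' using mat_inv(1)[OF G(3)] G(4) by (meson mult_carrier_mat)
  qed
  show ?thesis
    unfolding ind_section_def siegel
  proof (rule the_equality)
    fix f
    assume f: "f \<in> Ind n \<omega> \<and>
       (\<forall>p \<in> siegel_carrier n. \<forall>B \<in> carrier_mat n n. f (big_cell_elt n p B) = \<omega> p * \<psi> (mat_trace B)) \<and>
       (\<forall>g. f g \<noteq> 0 \<longrightarrow> (\<exists>p \<in> siegel_carrier n. \<exists>B \<in> carrier_mat n n. g = big_cell_elt n p B))"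
    show "f = ?f"
    proof
      fix g
      show "f g = ?f g"
      proof (cases "\<exists>p \<in> siegel_carrier n. \<exists>B \<in> carrier_mat n n. g = big_cell_elt n p B")
        case True
        thus ?thesis using f val by metis
      next
        case False
        thus ?thesis using f supp by metis
      qed
    qed
  qed (use Ind val supp in blast)
qed

section \<open>The intertwining operator\<close>

text \<open>The value \<open>Mf\<^sub>\<omega>(g)\<close> in terms of the blocks of \<open>g\<close>: the product of the two matrices in front of \<open>g\<close> moves
  \<open>-(a + Bc, b + Bd)\<close> into the bottom row.\<close>

definition intertwining_sum ::
    "nat \<Rightarrow> ('a :: field \<Rightarrow> complex) \<Rightarrow> ('a \<Rightarrow> complex) \<Rightarrow> 'a mat \<Rightarrow> 'a mat \<Rightarrow> 'a mat \<Rightarrow> 'a mat \<Rightarrow> complex" where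
  "intertwining_sum n \<psi> \<beta> a b c d =
     (\<Sum>B \<in> carrier_mat n n. bottom_row_section \<psi> \<beta> (- (a + B * c)) (- (b + B * d)))"

lemma intertwining_siegel_section:
  fixes a :: "'a :: field mat"
  assumes G: "a \<in> carrier_mat n n" "b \<in> carrier_mat n n" "c \<in> carrier_mat n n" "d \<in> carrier_mat n n"
    and g: "four_block_mat a b c d \<in> carrier (SL (2 * n))"
  shows "intertwining n (siegel_section n \<psi> \<beta>) (four_block_mat a b c d) = intertwining_sum n \<psi> \<beta> a b c d"
proof -
  let ?w = "four_block_mat (0\<^sub>m n n) (1\<^sub>m n) (- 1\<^sub>m n) (0\<^sub>m n n) :: 'a mat"
  have "siegel_section n \<psi> \<beta> (?w * unip n B * four_block_mat a b c d) =
      bottom_row_section \<psi> \<beta> (- (a + B * c)) (- (b + B * d))" if B: "B \<in> carrier_mat n n" for B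
  proof -
    have 1: "?w * unip n B = four_block_mat (0\<^sub>m n n) (1\<^sub>m n) (- 1\<^sub>m n) (- B)"
      unfolding unip_def using B
      by (subst mult_four_block_mat[of _ n n _ n _ n]) (auto intro!: cong_four_block_mat)
    have "(- 1\<^sub>m n) * x + (- B) * y = - (x + B * y)"
      if "x \<in> carrier_mat n n" "y \<in> carrier_mat n n" for x y
      using that B by (intro eq_matI) auto
    hence eq: "?w * unip n B * four_block_mat a b c d = four_block_mat c d (- (a + B * c)) (- (b + B * d))"
      unfolding 1 using G B
      by (subst mult_four_block_mat[of _ n n _ n _ n]) (auto intro!: cong_four_block_mat)
    moreover have "?w * unip n B * four_block_mat a b c d \<in> carrier (SL (2 * n))"
      by (intro SL_mult unip_SL weyl_SL B g)
    ultimately show ?thesis using G B by (auto intro!: siegel_section_block)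
  qed
  thus ?thesis unfolding intertwining_def intertwining_sum_def using g by simp
qed

text \<open>Two substitutions: \<open>Y = -(a + Bc)\<close> splits off the dependence on \<open>d\<close>, and \<open>Y = A Z\<inverse>\<close> with
  \<open>A = a c\<inverse> d - b\<close> yields the Gauss sum.\<close>

lemma intertwining_sum_big_cell:
  fixes a :: "'a :: {field, finite} mat"
  assumes \<beta>: "\<beta> \<in> characters (units_of class_ring)" "\<beta> 0 = 0"
    and \<psi>: "\<psi> \<in> characters (add_monoid class_ring)"
    and G: "a \<in> carrier_mat n n" "b \<in> carrier_mat n n" "c \<in> carrier_mat n n" "d \<in> carrier_mat n n"
    and g: "four_block_mat a b c d \<in> carrier (SL (2 * n))" and nz: "det c \<noteq> 0"
  shows "intertwining_sum n \<psi> \<beta> a b c d =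
    (\<Sum>B \<in> carrier (GL n). \<beta> (det B) * \<psi> (mat_trace B)) *
      bottom_row_section \<psi> (\<lambda>x. inverse (\<beta> x)) c d"
proof -
  let ?M = "carrier_mat n n :: 'a mat set" and ?F = "bottom_row_section \<psi> \<beta>"
  define C where "C = mat_inv c"
  have C: "C \<in> ?M" "c * C = 1\<^sub>m n" "C * c = 1\<^sub>m n" unfolding C_def using mat_inv[OF G(3)] nz by auto
  define A where "A = a * (C * d) - b"
  have A: "A \<in> ?M" unfolding A_def using G C by (intro minus_carrier_mat) auto
  \<comment> \<open>\<open>A\<close> is the upper diagonal block of the \<open>P\<close>-part of \<open>g\<close> in the big cell.\<close>
  have dA: "det A * det c = 1"
    using in_big_cell(1)[OF G g nz] A G unfolding A_def[symmetric] C_def[symmetric]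
    by (simp add: siegel_block_iff)
  hence Anz: "det A \<noteq> 0" by auto
  note Ai = mat_inv[OF A]
  have CcC: "X * c * C = X" "X * C * c = X" if "X \<in> ?M" for X
    using that G C by (simp_all add: assoc_mult_mat[of _ n n _ n _ n])
  have row: "- (b + B * d) = - (a + B * c) * (C * d) + A" if B: "B \<in> ?M" for B
  proof -
    have "B * c * (C * d) = B * c * C * d"
      using G B C by (intro assoc_mult_mat[symmetric, of _ n n _ n _ n]) auto
    hence "(a + B * c) * (C * d) = a * (C * d) + B * d"
      by (simp add: CcC(1)[OF B]
          add_mult_distrib_mat[OF G(1) mult_carrier_mat[OF B G(3)] mult_carrier_mat[OF C(1) G(4)]])
    hence "- (a + B * c) * (C * d) + A = - (a * (C * d) + B * d) + (a * (C * d) - b)"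
      using G B C unfolding A_def by simp
    also have "\<dots> = - (b + B * d)"
      using G B C by (intro eq_matI) auto
    finally show ?thesis ..
  qed
  have "intertwining_sum n \<psi> \<beta> a b c d = (\<Sum>B \<in> ?M. \<psi> (mat_trace (C * d)) * ?F (- (a + B * c)) A)"
    unfolding intertwining_sum_def
  proof (rule sum.cong)
    fix B assume B: "B \<in> ?M"
    show "?F (- (a + B * c)) (- (b + B * d)) = \<psi> (mat_trace (C * d)) * ?F (- (a + B * c)) A"
      unfolding row[OF B]
      by (rule bottom_row_section_right[where \<beta> = \<beta> and n = n, OF \<beta>(2) \<psi>]) (use G B C A in auto)
  qed simp
  also have "\<dots> = (\<Sum>Y \<in> ?M. \<psi> (mat_trace (C * d)) * ?F Y A)"
  proof (rule sum.reindex_bij_witness[of _ "\<lambda>Y. - (Y + a) * C" "\<lambda>B. - (a + B * c)"])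
    fix B assume B: "B \<in> ?M"
    have "- (- (a + B * c) + a) = B * c" using G B by (intro eq_matI) auto
    thus "- (- (a + B * c) + a) * C = B" using CcC[OF B] by simp
  next
    fix Y assume Y: "Y \<in> ?M"
    have "- (Y + a) * C * c = - (Y + a)" using G Y C by (intro CcC) auto
    hence "- (a + - (Y + a) * C * c) = - (a + - (Y + a))" by simp
    also have "\<dots> = Y" using G Y by (intro eq_matI) auto
    finally show "- (a + - (Y + a) * C * c) = Y" .
  qed (use G C in auto)
  also have "\<dots> = (\<Sum>Y \<in> carrier (GL n). \<psi> (mat_trace (C * d)) * ?F Y A)"
    by (rule sum.mono_neutral_right)
      (auto simp: GL_carrier bottom_row_section_def \<beta> intro: finite_carrier_mat)
  also have "\<dots> = (\<Sum>Z \<in> carrier (GL n). \<psi> (mat_trace (C * d)) * (\<beta> (det c) * (\<beta> (det Z) * \<psi> (mat_trace Z))))"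
  proof (rule sum.reindex_bij_witness[of _ "\<lambda>Z. A * mat_inv Z" "\<lambda>Y. mat_inv Y * A"])
    fix Y :: "'a mat" assume "Y \<in> carrier (GL n)"
    hence Y: "Y \<in> ?M" "det Y \<noteq> 0" by (auto simp: GL_carrier)
    note Yi = mat_inv[OF Y(1)]
    show YA: "mat_inv Y * A \<in> carrier (GL n)"
      using Y A Anz Yi by (auto simp: GL_carrier det_mult[of _ n] det_mat_inv)
    have "Y * (mat_inv Y * A) = A" using Y Yi A by (simp add: assoc_mult_mat[of _ n n _ n _ n, symmetric])
    hence "Y * (mat_inv Y * A) * mat_inv (mat_inv Y * A) = A * mat_inv (mat_inv Y * A)" by simp
    thus "A * mat_inv (mat_inv Y * A) = Y"
      using YA mat_inv[of "mat_inv Y * A" n] Y Yi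
      by (auto simp: GL_carrier assoc_mult_mat[of _ n n _ n _ n])
    have "det c * det (mat_inv Y * A) = inverse (det Y)"
      using Y A Yi dA by (simp add: det_mult[of _ n] det_mat_inv mult.commute mult.left_commute)
    moreover have "det (mat_inv Y * A) \<noteq> 0" using YA by (simp add: GL_carrier)
    ultimately have "\<beta> (det c) * \<beta> (det (mat_inv Y * A)) = inverse (\<beta> (det Y))"
      using characters_unitsD(1)[OF \<beta>(1) nz] characters_units_inverse[OF \<beta>] by metis
    thus "\<psi> (mat_trace (C * d)) * (\<beta> (det c) * (\<beta> (det (mat_inv Y * A)) * \<psi> (mat_trace (mat_inv Y * A))))
        = \<psi> (mat_trace (C * d)) * ?F Y A"
      by (simp add: bottom_row_section_def mult.assoc[symmetric])
  next
    fix Z :: "'a mat" assume "Z \<in> carrier (GL n)"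
    hence Z: "Z \<in> ?M" "det Z \<noteq> 0" by (auto simp: GL_carrier)
    note Zi = mat_inv[OF Z(1)]
    show AZ: "A * mat_inv Z \<in> carrier (GL n)"
      using Z A Anz Zi by (auto simp: GL_carrier det_mult[of _ n] det_mat_inv)
    have "A * mat_inv Z * Z = A" using Z Zi A by (simp add: assoc_mult_mat[of _ n n _ n _ n])
    hence "mat_inv (A * mat_inv Z) * A = mat_inv (A * mat_inv Z) * (A * mat_inv Z * Z)" by simp
    also have "\<dots> = mat_inv (A * mat_inv Z) * (A * mat_inv Z) * Z"
      using A Z Zi mat_inv(1)[of "A * mat_inv Z" n] by (subst assoc_mult_mat[of _ n n _ n _ n]) auto
    finally show "mat_inv (A * mat_inv Z) * A = Z"
      using AZ mat_inv[of "A * mat_inv Z" n] Z by (auto simp: GL_carrier)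
  qed
  finally show ?thesis
    unfolding bottom_row_section_def C_def
    by (simp add: sum_distrib_left sum_distrib_right mult_ac)
qed

text \<open>The quotient \<open>g' g\<inverse>\<close> has bottom row \<open>(0, 1)\<close>, because \<open>g g\<inverse> = 1\<close> does and the bottom rows of \<open>g\<close> and
  \<open>g'\<close> agree. Its upper blocks are \<open>A\<close> and \<open>X\<close>.\<close>

lemma SL_same_bottom_rows:
  fixes a :: "'a :: field mat"
  assumes G: "a \<in> carrier_mat n n" "b \<in> carrier_mat n n" "c \<in> carrier_mat n n" "d \<in> carrier_mat n n"
    and g: "four_block_mat a b c d \<in> carrier (SL (2 * n))"
    and b': "b' \<in> carrier_mat n n" and g': "four_block_mat a b' c d \<in> carrier (SL (2 * n))"
  obtains A X where "A \<in> carrier_mat n n" "X \<in> carrier_mat n n" "det A = 1"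
    "A * a + X * c = a" "A * b + X * d = b'"
proof -
  let ?g = "four_block_mat a b c d" and ?g' = "four_block_mat a b' c d"
  define h where "h = mat_inv ?g"
  have gc: "?g \<in> carrier_mat (2 * n) (2 * n)" "det ?g \<noteq> 0" "det ?g = 1"
    and g'c: "?g' \<in> carrier_mat (2 * n) (2 * n)" "det ?g' = 1"
    using g g' by (auto simp: SL_carrier_iff)
  have h: "h \<in> carrier_mat (2 * n) (2 * n)" "?g * h = 1\<^sub>m (2 * n)" "h * ?g = 1\<^sub>m (2 * n)" "det h = 1"
    unfolding h_def using mat_inv[OF gc(1)] gc det_mat_inv[OF gc(1)] by auto
  hence "h \<in> carrier (SL (2 * n))" by (simp add: SL_carrier_iff)
  then obtain p q r s where H: "p \<in> carrier_mat n n" "q \<in> carrier_mat n n" "r \<in> carrier_mat n n"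
    "s \<in> carrier_mat n n" and h': "h = four_block_mat p q r s" by (rule SL_blocks)
  define A where "A = a * p + b' * r"
  define X where "X = a * q + b' * s"
  have AX: "A \<in> carrier_mat n n" "X \<in> carrier_mat n n" unfolding A_def X_def using G H b' by auto
  have "four_block_mat (a * p + b * r) (a * q + b * s) (c * p + d * r) (c * q + d * s) =
      four_block_mat (1\<^sub>m n) (0\<^sub>m n n) (0\<^sub>m n n) (1\<^sub>m n)"
    using h(2) mult_four_block_mat[OF G H] unfolding h' by (simp add: mult_2)
  from four_block_mat_inject[OF _ _ _ _ _ _ _ _ this, of n n n n]
  have 1: "c * p + d * r = 0\<^sub>m n n" "c * q + d * s = 1\<^sub>m n" using G H by auto
  have gh: "?g' * h = four_block_mat A X (0\<^sub>m n n) (1\<^sub>m n)"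
    unfolding h' mult_four_block_mat[OF G(1) b' G(3,4) H] 1 A_def X_def ..
  have "det (?g' * h) = 1" using g'c h by (simp add: det_mult[of _ "2 * n"])
  hence "det A = 1" unfolding gh using AX by (simp add: det_four_block_mat_lower_left_zero[of _ n _ n])
  have "?g' = ?g' * h * ?g" 
    using g'c h gc right_mult_one_mat[OF g'c(1)]
    by (simp add: assoc_mult_mat[of _ "2 * n" "2 * n" _ "2 * n" _ "2 * n"])
  hence "four_block_mat a b' c d = four_block_mat (A * a + X * c) (A * b + X * d)
      (0\<^sub>m n n * a + 1\<^sub>m n * c) (0\<^sub>m n n * b + 1\<^sub>m n * d)"
    unfolding gh mult_four_block_mat[OF AX zero_carrier_mat one_carrier_mat G] .
  from four_block_mat_inject[OF _ _ _ _ _ _ _ _ this, of n n n n]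
  have "A * a + X * c = a" "A * b + X * d = b'" using G AX b' by auto
  with that AX \<open>det A = 1\<close> show ?thesis by blast
qed

text \<open>The matrix \<open>N\<close> with \<open>c N = 0\<close> and the relation \<open>(A a + X c, A b + X d) = (a, a N + b)\<close> compare the summand
  at \<open>B\<close> with the one at \<open>A B - X\<close>: they differ by the factor \<open>\<psi>(tr N)\<close>. As \<open>B \<mapsto> A B - X\<close> is a
  bijection, the sum equals \<open>\<psi>(tr N)\<close> times itself.\<close>

lemma intertwining_sum_off_big_cell:
  fixes a :: "'a :: field mat"
  assumes \<beta>: "\<beta> \<in> characters (units_of class_ring)" "\<beta> 0 = 0"
    and \<psi>: "\<psi> \<in> characters (add_monoid class_ring)" "\<psi> x \<noteq> 1"
    and G: "a \<in> carrier_mat n n" "b \<in> carrier_mat n n" "c \<in> carrier_mat n n" "d \<in> carrier_mat n n"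
    and g: "four_block_mat a b c d \<in> carrier (SL (2 * n))" and c0: "det c = 0"
  shows "intertwining_sum n \<psi> \<beta> a b c d = 0"
proof -
  let ?M = "carrier_mat n n :: 'a mat set" and ?F = "bottom_row_section \<psi> \<beta>"
  obtain N where N: "N \<in> ?M" "c * N = 0\<^sub>m n n" "mat_trace N = x"
    using exists_trace_annihilated[OF G(3) c0] .
  have "four_block_mat a b c d * unip n N = four_block_mat a (a * N + b) c d"
    unfolding unip_def using G N by (subst mult_four_block_mat[of _ n n _ n _ n]) auto
  hence "four_block_mat a (a * N + b) c d \<in> carrier (SL (2 * n))"
    using SL_mult[OF g unip_SL[OF N(1)]] by simp
  then obtain A X where AX: "A \<in> ?M" "X \<in> ?M" "det A = 1" "A * a + X * c = a" "A * b + X * d = a * N + b"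
    using SL_same_bottom_rows[OF G g, of "a * N + b"] G N by (metis add_carrier_mat mult_carrier_mat)
  note Ai = mat_inv[OF AX(1)]
  define T where "T B = ?F (- (a + B * c)) (- (b + B * d))" for B
  have step: "T B = \<psi> x * T (A * B - X)" if B: "B \<in> ?M" for B
  proof -
    define B' where "B' = A * B - X"
    have B': "B' \<in> ?M" unfolding B'_def using AX B by (intro minus_carrier_mat) auto
    have AB: "A * B = B' + X" unfolding B'_def using AX B by (intro eq_matI) auto
    have distr: "A * (u + B * v) = (A * u + X * v) + B' * v" if "u \<in> ?M" "v \<in> ?M" for u v
    proof -
      have "A * (u + B * v) = A * u + A * B * v"
        using AX B that by (simp add: mult_add_distrib_mat[of _ n n _ n] assoc_mult_mat[of _ n n _ n _ n])
      also have "\<dots> = A * u + (B' * v + X * v)"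
        unfolding AB using AX B' that by (simp add: add_mult_distrib_mat[of _ n n])
      also have "\<dots> = (A * u + X * v) + B' * v" using AX B' that by (intro eq_matI) auto
      finally show ?thesis .
    qed
    have 1: "A * - (a + B * c) = - (a + B' * c)"
      using distr[OF G(1,3)] AX G B by simp
    have "(a + B' * c) * N = a * N"
      using G B' N by (simp add: add_mult_distrib_mat[of _ n n] assoc_mult_mat[of _ n n _ n _ n])
    moreover have "- (a * N + b + B' * d) = - (a * N) + - (b + B' * d)"
      using G B' N by (intro eq_matI) auto
    ultimately have 2: "A * - (b + B * d) = - (a + B' * c) * N + - (b + B' * d)"
      using distr[OF G(2,4)] AX G B B' N by simp
    have "T B = ?F (A * - (a + B * c)) (A * - (b + B * d))"
      unfolding T_def using AX G B characters_units_one[OF \<beta>(1)]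
      by (subst bottom_row_section_left[OF \<beta>, of A n]) auto
    also have "\<dots> = \<psi> x * T B'"
      unfolding 1 2 T_def N(3)[symmetric]
      by (rule bottom_row_section_right[where \<beta> = \<beta> and n = n, OF \<beta>(2) \<psi>(1)]) (use G B' N in auto)
    finally show ?thesis unfolding B'_def .
  qed
  have "(\<Sum>B \<in> ?M. T B) = (\<Sum>B \<in> ?M. \<psi> x * T B)"
  proof (rule sum.reindex_bij_witness[of _ "\<lambda>B. mat_inv A * (B + X)" "\<lambda>B. A * B - X"])
    fix B assume B: "B \<in> ?M"
    show "A * B - X \<in> ?M" using AX B by (intro minus_carrier_mat) auto
    have "A * B - X + X = A * B" using AX B by (intro eq_matI) auto
    thus "mat_inv A * (A * B - X + X) = B"
      using AX B Ai by (simp add: assoc_mult_mat[of _ n n _ n _ n, symmetric])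
    have "A * (mat_inv A * (B + X)) = B + X"
      using AX B Ai by (simp add: assoc_mult_mat[of _ n n _ n _ n, symmetric])
    moreover have "B + X - X = B" using AX B by (intro eq_matI) auto
    ultimately show "A * (mat_inv A * (B + X)) - X = B" by simp
    show "mat_inv A * (B + X) \<in> ?M" using AX B Ai by auto
    show "\<psi> x * T (A * B - X) = T B" using step[OF B] by simp
  qed
  also have "\<dots> = \<psi> x * (\<Sum>B \<in> ?M. T B)" by (simp add: sum_distrib_left)
  finally have "(1 - \<psi> x) * (\<Sum>B \<in> ?M. T B) = 0" by (simp add: algebra_simps)
  thus ?thesis using \<psi>(2) by (simp add: intertwining_sum_def T_def)
qed

theorem theorem1p0p2:
  fixes n :: nat
    and \<psi> :: "'a :: {field, finite} \<Rightarrow> complex"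
    and \<omega> :: "'a mat \<Rightarrow> complex"
  assumes "\<not> 2 dvd CARD('a)" and "\<not> 3 dvd CARD('a)"
    and "n \<ge> 1"
    and "\<psi> \<in> characters (add_monoid class_ring)" and "\<exists>x. \<psi> x \<noteq> 1"
    and "\<omega> \<in> characters (siegel n)"
  shows "intertwining n (ind_section n \<psi> \<omega>) =
    (\<lambda>g. (\<Sum>B \<in> carrier (GL n). det_character n \<omega> (det B) * \<psi> (mat_trace B)) *
         ind_section n \<psi> (swap_character n \<omega>) g)"
proof -
  obtain t :: 'a where t: "t \<noteq> 0" "t\<^sup>2 \<noteq> 1"
    using exists_nonzero_square_ne_one assms(1,2) by blast
  obtain \<beta> where \<beta>: "\<beta> \<in> characters (units_of class_ring)" "\<beta> 0 = 0"
    and \<omega>: "\<And>A B D. A \<in> carrier_mat n n \<Longrightarrow> B \<in> carrier_mat n n \<Longrightarrow> D \<in> carrier_mat n n \<Longrightarrow>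
       det A * det D = 1 \<Longrightarrow> \<omega> (four_block_mat A B (0\<^sub>m n n) D) = \<beta> (det A)"
    using siegel_character_factors_through_det[OF assms(3) t assms(6)] by blast
  \<comment> \<open>The character that corresponds to \<open>\<omega>'\<close>: it is \<open>\<beta>(det D)\<close>, and \<open>det D = (det A)\<inverse>\<close>.\<close>
  let ?\<beta>' = "\<lambda>x. inverse (\<beta> x)"
  have \<beta>': "?\<beta>' \<in> characters (units_of class_ring)" "?\<beta>' 0 = 0"
    using \<beta> characters_unitsD[OF \<beta>(1)] by (auto intro!: characters_unitsI)
  have swap: "swap_character n \<omega> (four_block_mat A B (0\<^sub>m n n) D) = ?\<beta>' (det A)"
    if c: "A \<in> carrier_mat n n" "B \<in> carrier_mat n n" "D \<in> carrier_mat n n" and d: "det A * det D = 1"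
    for A B D
    using \<omega>[OF c(3) zero_carrier_mat c(1)] c d characters_units_inverse[OF \<beta>, of "det A"] inverse_unique[OF d]
    by (simp add: swap_character_def split_block_four_block_mat[of _ n n _ n _ n] mult.commute)
  let ?G = "\<Sum>B \<in> carrier (GL n). \<beta> (det B) * \<psi> (mat_trace B)"
  obtain x where x: "\<psi> x \<noteq> 1" using assms(5) by blast
  have "intertwining n (siegel_section n \<psi> \<beta>) g = ?G * siegel_section n \<psi> ?\<beta>' g" for g
  proof (cases "g \<in> carrier (SL (2 * n))")
    case True
    then obtain a b c d where G: "a \<in> carrier_mat n n" "b \<in> carrier_mat n n" "c \<in> carrier_mat n n"
      "d \<in> carrier_mat n n" and g: "g = four_block_mat a b c d" by (rule SL_blocks)
    note SL = True[unfolded g]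
    show ?thesis
      unfolding g intertwining_siegel_section[OF G SL] siegel_section_block[OF G SL]
    proof (cases "det c = 0")
      case True
      thus "intertwining_sum n \<psi> \<beta> a b c d = ?G * bottom_row_section \<psi> ?\<beta>' c d"
        using intertwining_sum_off_big_cell[OF \<beta> assms(4) x G SL] \<beta>(2) by (simp add: bottom_row_section_def)
    next
      case False
      thus "intertwining_sum n \<psi> \<beta> a b c d = ?G * bottom_row_section \<psi> ?\<beta>' c d"
        by (rule intertwining_sum_big_cell[OF \<beta> assms(4) G SL])
    qed
  qed (simp add: intertwining_def siegel_section_def)
  moreover have "det_character n \<omega> = \<beta>" by (rule det_character_eq[OF assms(3) \<beta> \<omega>])
  moreover have "ind_section n \<psi> \<omega> = siegel_section n \<psi> \<beta>" by (rule ind_section_eq[OF \<beta> assms(4) \<omega>])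
  moreover have "ind_section n \<psi> (swap_character n \<omega>) = siegel_section n \<psi> ?\<beta>'"
    by (rule ind_section_eq[OF \<beta>' assms(4) swap])
  ultimately show ?thesis by (intro ext) simp
qed

end
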